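(* Let $d \geq 2$ and $m \geq 2$ be integers and let $p > 2$ be real. Then the following assertion is false: "For any smooth domain $D \subset \mathbb{R}^d$, any $p$-rough path $\mathbf{X}$ on $[0,1]$ over an $\mathbb{R}^m$-valued path, any $f \in C^\infty(\mathbb{R}^d, L(\mathbb{R}^m,\mathbb{R}^d))$ and any $y_0 \in D$, the reflected rough differential equation $$dY_t = f(Y_t)\, d\mathbf{X}_t + d\kappa_t, \quad Y_0 = y_0, \qquad Y_t \in D \ \ \forall t\in[0,1], \qquad d\kappa_t = 1_{\{Y_t \in \partial D\}}\, n(Y_t)\, |d\kappa_t|,$$ admits at most one solution $(Y,\kappa)$ on $[0,1]$."
   Context: A smooth domain $D\subset\mathbb{R}^d$ here is a closed domain (closure of a connected open set) with $C^\infty$ boundary; $n(y)$ denotes the inner unit normal of $D$ at $y\in\partial D$. $L(\mathbb{R}^m,\mathbb{R}^d)$ is the space of linear maps; write $f=(f_1,\dots,f_m)$, each $f_i$ being a smooth vector field on $\mathbb{R}^d$. A $p$-rough path over a path $X:[0,1]\to\mathbb{R}^m$ is a continuous (weakly geometric) rough path $\mathbf{X}=(1,\mathbf{X}^1,\dots,\mathbf{X}^{N})$, $N=\lfloor p\rfloor$, of finite $p$-variation, with $\mathbf{X}^1_{s,t}=X_t-X_s$, in the usual sense of rough path theory. A solution is a pair $(Y,\kappa)$ of continuous paths $[0,1]\to\mathbb{R}^d$ with $Y_0=y_0$, $\kappa_0=0$, $\kappa$ of bounded variation, $Y_t\in D$ for all $t$, $d\kappa_t = 1_{\{Y_t \in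 \partial D\}} n(Y_t)|d\kappa_t|$ (where $|d\kappa|$ is the total variation measure of $\kappa$), and such that $Y_t-Y_s=\int_s^t f(Y_u)\,d\mathbf{X}_u+\kappa_t-\kappa_s$ in the sense of rough integration. Concretely, there are a control function $\omega$ and an exponent $\theta>1$ such that for all $0\le s\le t\le1$ $$\Big|Y_t-Y_s-(\kappa_t-\kappa_s)-\sum_{k=1}^{N}\ \sum_{i_1,\dots,i_k=1}^m (f_{i_1}\cdots f_{i_k}\mathrm{Id})(Y_s)\,\mathbf{X}^{k;i_1,\dots,i_k}_{s,t}\Big|\le \omega(s,t)^\theta,$$ where vector fields are identified with first-order differential operators and $\mathrm{Id}$ is the identity function of $\mathbb{R}^d$. A control function is a continuous map $\omega:\{0\le s\le t\le 1\}\to[0,\infty)$, zero on the diagonal, with $\omega(s,u)+\omega(u,t)\le\omega(s,t)$ for $s\le u\le t$. *)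

theory Defs
  imports "HOL-Analysis.Analysis"
begin

section \<open>Smooth maps and smooth domains\<close>

text \<open>
  On an open set \<open>S\<close> of a Euclidean space, \<open>Ck_on n S f\<close> is the usual notion of an \<open>n\<close> times
  continuously differentiable map: all iterated directional derivatives of order at most \<open>n\<close>
  exist and are continuous.
\<close>

primrec Ck_on :: "nat \<Rightarrow> 'a::euclidean_space set \<Rightarrow> ('a \<Rightarrow> 'b::real_normed_vector) \<Rightarrow> bool" where
  "Ck_on 0 S f \<longleftrightarrow> continuous_on S f"
| "Ck_on (Suc n) S f \<longleftrightarrow>
     (\<forall>x\<in>S. f differentiable (at x)) \<and>
     (\<forall>v. Ck_on n S (\<lambda>x. frechet_derivative f (at x) v))"

definition smooth_on :: "'a::euclidean_space set \<Rightarrow> ('a \<Rightarrow> 'b::real_normed_vector) \<Rightarrow> bool" where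
  "smooth_on S f \<longleftrightarrow> (\<forall>n. Ck_on n S f)"

text \<open>\<open>\<phi>\<close> is a smooth defining function of \<open>D\<close> in the neighbourhood \<open>V\<close> of \<open>y\<close>.\<close>

definition local_defining_function ::
    "'a::euclidean_space set \<Rightarrow> 'a \<Rightarrow> 'a set \<Rightarrow> ('a \<Rightarrow> real) \<Rightarrow> bool" where
  "local_defining_function D y V \<phi> \<longleftrightarrow>
     open V \<and> y \<in> V \<and> smooth_on V \<phi> \<and>
     (\<forall>x\<in>V. \<exists>g. GDERIV \<phi> x :> g \<and> g \<noteq> 0) \<and>
     D \<inter> V = {x \<in> V. 0 \<le> \<phi> x}"

definition smooth_domain :: "'a::euclidean_space set \<Rightarrow> bool" where
  "smooth_domain D \<longleftrightarrow>
     (\<exists>U. open U \<and> connected U \<and> U \<noteq> {} \<and> D = closure U) \<and>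
     (\<forall>y\<in>frontier D. \<exists>V \<phi>. local_defining_function D y V \<phi>)"

text \<open>
  The inner unit normal is the normalised gradient of a defining function, which points into
  \<open>D = {\<phi> \<ge> 0}\<close>. It does not depend on the defining function; see \<open>inner_normal_eqI\<close> below.
\<close>

definition inner_normal :: "'a::euclidean_space set \<Rightarrow> 'a \<Rightarrow> 'a" where
  "inner_normal D y =
     (THE \<nu>. \<exists>V \<phi> g. local_defining_function D y V \<phi> \<and> GDERIV \<phi> y :> g \<and> \<nu> = sgn g)"

lemma GDERIV_pos_ray:
  fixes \<phi> :: "'a::euclidean_space \<Rightarrow> real"
  assumes "GDERIV \<phi> y :> g" and "0 < h \<bullet> g"
  shows "\<exists>e>0. \<forall>t. 0 < t \<and> t < e \<longrightarrow> \<phi> y < \<phi> (y + t *\<^sub>R h)"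
proof -
  have "((\<lambda>t::real. y + t *\<^sub>R h) has_derivative (\<lambda>t. t *\<^sub>R h)) (at 0)"
    by (auto intro!: derivative_eq_intros)
  moreover have "(\<phi> has_derivative (\<lambda>h. h \<bullet> g)) (at (y + 0 *\<^sub>R h))"
    using assms(1) by (simp add: gderiv_def)
  ultimately have "((\<lambda>t. \<phi> (y + t *\<^sub>R h)) has_derivative (\<lambda>t. (t *\<^sub>R h) \<bullet> g)) (at 0)"
    by (rule has_derivative_compose)
  then have "DERIV (\<lambda>t. \<phi> (y + t *\<^sub>R h)) 0 :> h \<bullet> g"
    by (simp add: has_field_derivative_def mult.commute[of _ "h \<bullet> g"])
  from DERIV_pos_inc_right[OF this assms(2)] show ?thesis
    by auto
qed

lemma mem_iff_nonneg:
  fixes \<phi> :: "'a \<Rightarrow> real"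
  assumes "D \<inter> V = {x \<in> V. 0 \<le> \<phi> x}" and "x \<in> V"
  shows "x \<in> D \<longleftrightarrow> 0 \<le> \<phi> x"
  using assms by blast

lemma local_defining_function_halfspace:
  fixes D :: "'a::euclidean_space set"
  assumes y: "y \<in> frontier D"
    and \<phi>: "local_defining_function D y V \<phi>" "GDERIV \<phi> y :> g"
    and \<psi>: "local_defining_function D y W \<psi>" "GDERIV \<psi> y :> k"
    and h: "0 < h \<bullet> g"
  shows "0 \<le> h \<bullet> k"
proof (rule ccontr)
  assume "\<not> 0 \<le> h \<bullet> k"
  then have hk: "0 < (- h) \<bullet> k" by simp
  have zero: "\<eta> y = 0" if "local_defining_function D y U \<eta>" "GDERIV \<eta> y :> l" for U \<eta> l
  proof -
    have U: "open U" "y \<in> U" "D \<inter> U = {x \<in> U. 0 \<le> \<eta> x}" and sm: "smooth_on U \<eta>"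
      using that by (auto simp: local_defining_function_def)
    have cont: "continuous_on U \<eta>"
      using sm unfolding smooth_on_def by (metis Ck_on.simps(1))
    have "open (U \<inter> \<eta> -` {0<..})" "open (U \<inter> \<eta> -` {..<0})"
      by (auto intro!: continuous_open_preimage[OF cont U(1)])
    moreover have "U \<inter> \<eta> -` {0<..} \<subseteq> D" "U \<inter> \<eta> -` {..<0} \<subseteq> - D"
      using mem_iff_nonneg[OF U(3)] by fastforce+
    ultimately have "U \<inter> \<eta> -` {0<..} \<subseteq> interior D" "U \<inter> \<eta> -` {..<0} \<subseteq> interior (- D)"
      by (simp_all add: interior_maximal)
    moreover have "y \<notin> interior D" "y \<notin> interior (- D)"
      using y by (auto simp: frontier_def interior_complement)
    ultimately have "\<not> 0 < \<eta> y" "\<not> \<eta> y < 0"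
      using U(2) by auto
    then show ?thesis by simp
  qed
  have V: "open V" "y \<in> V" "D \<inter> V = {x \<in> V. 0 \<le> \<phi> x}"
    and W: "open W" "y \<in> W" "D \<inter> W = {x \<in> W. 0 \<le> \<psi> x}"
    using \<phi> \<psi> by (auto simp: local_defining_function_def)
  have "GDERIV (\<lambda>x. - \<psi> x) y :> - k"
    using \<psi>(2) by (auto simp: gderiv_def intro!: derivative_eq_intros)
  from GDERIV_pos_ray[OF this, of h] hk zero[OF \<psi>] obtain e1 where
    e1: "e1 > 0" "\<And>t. 0 < t \<Longrightarrow> t < e1 \<Longrightarrow> \<psi> (y + t *\<^sub>R h) < 0" by auto
  from GDERIV_pos_ray[OF \<phi>(2) h] zero[OF \<phi>] obtain e2 where
    e2: "e2 > 0" "\<And>t. 0 < t \<Longrightarrow> t < e2 \<Longrightarrow> 0 < \<phi> (y + t *\<^sub>R h)" by auto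
  have "((\<lambda>t::real. y + t *\<^sub>R h) \<longlongrightarrow> y + 0 *\<^sub>R h) (at_right 0)"
    by (intro tendsto_intros)
  then have "eventually (\<lambda>t. y + t *\<^sub>R h \<in> V \<inter> W) (at_right (0::real))"
    by (rule topological_tendstoD) (use V W in auto)
  moreover have "eventually (\<lambda>t. 0 < t \<and> t < min e1 e2) (at_right (0::real))"
    unfolding eventually_at_right_field using e1(1) e2(1) by (intro exI[of _ "min e1 e2"]) simp
  ultimately have "eventually (\<lambda>t::real. False) (at_right 0)"
  proof eventually_elim
    case (elim t)
    then have "0 < \<phi> (y + t *\<^sub>R h)" "\<psi> (y + t *\<^sub>R h) < 0"
      using e1(2) e2(2) by auto
    moreover have "y + t *\<^sub>R h \<in> D"
      using elim \<open>0 < \<phi> (y + t *\<^sub>R h)\<close> by (simp add: mem_iff_nonneg[OF V(3)])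
    ultimately show ?case
      using elim by (simp add: mem_iff_nonneg[OF W(3)])
  qed
  then show False by simp
qed

lemma inner_normal_eqI:
  fixes D :: "'a::euclidean_space set"
  assumes y: "y \<in> frontier D"
    and \<phi>: "local_defining_function D y V \<phi>" "GDERIV \<phi> y :> g"
  shows "inner_normal D y = sgn g"
  unfolding inner_normal_def
proof (rule the_equality)
  fix \<nu> assume "\<exists>V \<phi> g. local_defining_function D y V \<phi> \<and> GDERIV \<phi> y :> g \<and> \<nu> = sgn g"
  then obtain W \<psi> k where \<psi>: "local_defining_function D y W \<psi>" "GDERIV \<psi> y :> k" "\<nu> = sgn k"
    by blast
  have nz: "l \<noteq> 0" if "local_defining_function D y U \<eta>" "GDERIV \<eta> y :> l" for U \<eta> l
  proof -
    have "\<exists>l'. GDERIV \<eta> y :> l' \<and> l' \<noteq> 0"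
      using that(1) by (simp add: local_defining_function_def)
    then obtain l' where l': "GDERIV \<eta> y :> l'" "l' \<noteq> 0" by blast
    have "(\<lambda>h. h \<bullet> l) = (\<lambda>h. h \<bullet> l')"
      using that(2) l'(1) unfolding gderiv_def by (rule has_derivative_unique)
    then have "l = l'" by (simp add: fun_eq_iff vector_eq_ldot)
    with l' show ?thesis by simp
  qed
  define a where "a = sgn g"
  define b where "b = sgn k"
  have ab: "norm a = 1" "norm b = 1" "g = norm g *\<^sub>R a" "k = norm k *\<^sub>R b" "0 < norm g" "0 < norm k"
    using nz[OF \<phi>] nz[OF \<psi>(1,2)] by (simp_all add: a_def b_def norm_sgn) (simp_all add: sgn_div_norm)
  have half: "0 \<le> h \<bullet> b" if "0 < h \<bullet> a" for h
  proof -
    have "0 < h \<bullet> g" using that ab(5) by (subst ab(3)) simp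
    from local_defining_function_halfspace[OF y \<phi> \<psi>(1,2) this] have "0 \<le> norm k * (h \<bullet> b)"
      by (subst (asm) ab(4)) simp
    then show ?thesis using ab(6) by (simp add: zero_le_mult_iff)
  qed
  have "a = b"
  proof (rule ccontr)
    assume "a \<noteq> b"
    have "a \<bullet> a = 1" "b \<bullet> b = 1" using ab by (simp_all add: dot_square_norm)
    have "0 < (a - b) \<bullet> (a - b)" using \<open>a \<noteq> b\<close> by simp
    then have lt: "a \<bullet> b < 1"
      using \<open>a \<bullet> a = 1\<close> \<open>b \<bullet> b = 1\<close> by (simp add: inner_diff inner_commute algebra_simps)
    have "0 < (a - b) \<bullet> a" using lt \<open>a \<bullet> a = 1\<close> by (simp add: inner_diff inner_commute)
    then have "0 \<le> (a - b) \<bullet> b" by (rule half)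
    then show False using lt \<open>b \<bullet> b = 1\<close> by (simp add: inner_diff)
  qed
  then show "\<nu> = sgn g" using \<psi>(3) by (simp add: a_def b_def)
qed (use \<phi> in blast)

section \<open>Variation\<close>

text \<open>
  \<open>variation_sums q \<Xi> s t\<close> collects the sums of \<open>\<bar>\<Xi> u v\<bar> powr q\<close> over consecutive points
  \<open>u \<le> v\<close> of a finite partition of (a subinterval of) \<open>[s, t]\<close>; \<open>\<Xi>\<close> stands for the size of an
  increment.
\<close>

definition variation_sums :: "real \<Rightarrow> (real \<Rightarrow> real \<Rightarrow> real) \<Rightarrow> real \<Rightarrow> real \<Rightarrow> real set" where
  "variation_sums q \<Xi> s t =
     {\<Sum>i<n. \<bar>\<Xi> (\<tau> i) (\<tau> (Suc i))\<bar> powr q | n \<tau>. mono_on {..n} \<tau> \<and> \<tau> ` {..n} \<subseteq> {s..t}}"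

abbreviation path_variation_sums ::
    "(real \<Rightarrow> 'a::real_normed_vector) \<Rightarrow> real \<Rightarrow> real \<Rightarrow> real set" where
  "path_variation_sums \<kappa> \<equiv> variation_sums 1 (\<lambda>u v. norm (\<kappa> v - \<kappa> u))"

definition bounded_variation_01 :: "(real \<Rightarrow> 'a::real_normed_vector) \<Rightarrow> bool" where
  "bounded_variation_01 \<kappa> \<longleftrightarrow> bdd_above (path_variation_sums \<kappa> 0 1)"

definition total_variation :: "(real \<Rightarrow> 'a::real_normed_vector) \<Rightarrow> real \<Rightarrow> real \<Rightarrow> real" where
  "total_variation \<kappa> s t = Sup (path_variation_sums \<kappa> s t)"

text \<open>
  The measure \<open>|d\<kappa>|\<close> of a continuous path \<open>\<kappa>\<close> of bounded variation on \<open>[0, 1]\<close>: the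
  Lebesgue--Stieltjes measure of its total variation function, which is extended to the real
  line as a constant on either side of \<open>[0, 1]\<close>.
\<close>

definition variation_measure :: "(real \<Rightarrow> 'a::real_normed_vector) \<Rightarrow> real measure" where
  "variation_measure \<kappa> = interval_measure (\<lambda>t. total_variation \<kappa> 0 (max 0 (min 1 t)))"

section \<open>Rough paths\<close>

text \<open>
  A two-parameter family with values in the truncated tensor algebra over \<open>\<real>\<^sup>m\<close> is given by its
  coordinates \<open>X s t w\<close>, where \<open>w = [i\<^sub>1, \<dots>, i\<^sub>k]\<close> is a word with letters in the index type; the
  level \<open>k\<close> consists of the words of length \<open>k\<close>. Words longer than \<open>\<lfloor>p\<rfloor>\<close> play no role.
\<close>

type_synonym 'm tensor_flow = "real \<Rightarrow> real \<Rightarrow> 'm list \<Rightarrow> real"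

text \<open>All shuffles of two words, with multiplicities (unlike \<open>shuffles\<close>).\<close>

fun shuffle_list :: "'a list \<Rightarrow> 'a list \<Rightarrow> 'a list list" where
  "shuffle_list [] v = [v]"
| "shuffle_list (i # u) [] = [i # u]"
| "shuffle_list (i # u) (j # v) =
     map ((#) i) (shuffle_list u (j # v)) @ map ((#) j) (shuffle_list (i # u) v)"

text \<open>The Euclidean norm of the \<open>k\<close>-th tensor level.\<close>

definition level_norm :: "nat \<Rightarrow> ('m::finite list \<Rightarrow> real) \<Rightarrow> real" where
  "level_norm k \<xi> = L2_set \<xi> {w. length w = k}"

text \<open>
  Weakly geometric \<open>p\<close>-rough paths on \<open>[0, 1]\<close> over the path \<open>x\<close>: the assumptions are, in order,
  the normalisation of the levels 0 and 1, Chen's relation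
  \<open>X\<^sub>s\<^sub>,\<^sub>t = X\<^sub>s\<^sub>,\<^sub>u \<otimes> X\<^sub>u\<^sub>,\<^sub>t\<close>, the shuffle relations (every \<open>X\<^sub>s\<^sub>,\<^sub>t\<close> lies in the free nilpotent
  group of step \<open>\<lfloor>p\<rfloor>\<close>), continuity, and finite \<open>p\<close>-variation, i.e. finite \<open>p/k\<close>-variation of the
  level \<open>k\<close>.
\<close>

definition rough_path :: "real \<Rightarrow> (real \<Rightarrow> real ^ 'm::finite) \<Rightarrow> 'm tensor_flow \<Rightarrow> bool" where
  "rough_path p x X \<longleftrightarrow>
     (\<forall>s t. 0 \<le> s \<and> s \<le> t \<and> t \<le> 1 \<longrightarrow>
        X s t [] = 1 \<and> (\<forall>i. X s t [i] = x t $ i - x s $ i)) \<and>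
     (\<forall>s u t w. 0 \<le> s \<and> s \<le> u \<and> u \<le> t \<and> t \<le> 1 \<and> length w \<le> nat \<lfloor>p\<rfloor> \<longrightarrow>
        X s t w = (\<Sum>j\<le>length w. X s u (take j w) * X u t (drop j w))) \<and>
     (\<forall>s t v w. 0 \<le> s \<and> s \<le> t \<and> t \<le> 1 \<and> length v + length w \<le> nat \<lfloor>p\<rfloor> \<longrightarrow>
        X s t v * X s t w = (\<Sum>z\<leftarrow>shuffle_list v w. X s t z)) \<and>
     (\<forall>w. length w \<le> nat \<lfloor>p\<rfloor> \<longrightarrow>
        continuous_on {(s, t). 0 \<le> s \<and> s \<le> t \<and> t \<le> 1} (\<lambda>(s, t). X s t w)) \<and>
     (\<forall>k\<in>{1..nat \<lfloor>p\<rfloor>}. bdd_above (variation_sums (p / k) (\<lambda>s t. level_norm k (X s t)) 0 1))"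

section \<open>Reflected rough differential equations\<close>

definition control_function :: "(real \<Rightarrow> real \<Rightarrow> real) \<Rightarrow> bool" where
  "control_function \<omega> \<longleftrightarrow>
     continuous_on {(s, t). 0 \<le> s \<and> s \<le> t \<and> t \<le> 1} (\<lambda>(s, t). \<omega> s t) \<and>
     (\<forall>s t. 0 \<le> s \<and> s \<le> t \<and> t \<le> 1 \<longrightarrow> 0 \<le> \<omega> s t) \<and>
     (\<forall>t\<in>{0..1}. \<omega> t t = 0) \<and>
     (\<forall>s u t. 0 \<le> s \<and> s \<le> u \<and> u \<le> t \<and> t \<le> 1 \<longrightarrow> \<omega> s u + \<omega> u t \<le> \<omega> s t)"

definition vector_field :: "('d \<Rightarrow> (real ^ 'm) \<Rightarrow>\<^sub>L 'd) \<Rightarrow> 'm::finite \<Rightarrow> 'd \<Rightarrow> 'd::euclidean_space" where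
  "vector_field f i y = blinfun_apply (f y) (axis i 1)"

text \<open>
  \<open>iterated_field f [i\<^sub>1, \<dots>, i\<^sub>k] = f\<^sub>i\<^sub>1 (\<dots> (f\<^sub>i\<^sub>k Id))\<close>, a vector field \<open>V\<close> acting on functions by
  \<open>(V F) y = DF(y)[V y]\<close>.
\<close>

primrec iterated_field ::
    "('d \<Rightarrow> (real ^ 'm) \<Rightarrow>\<^sub>L 'd) \<Rightarrow> 'm::finite list \<Rightarrow> 'd \<Rightarrow> 'd::euclidean_space" where
  "iterated_field f [] = (\<lambda>y. y)"
| "iterated_field f (i # w) =
     (\<lambda>y. frechet_derivative (iterated_field f w) (at y) (vector_field f i y))"

text \<open>\<open>Y\<^sub>t - Y\<^sub>s = \<integral>\<^sub>s\<^sup>t f(Y) dX + \<kappa>\<^sub>t - \<kappa>\<^sub>s\<close> in the sense of rough integration.\<close>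

definition rough_integral_equation ::
    "real \<Rightarrow> 'm::finite tensor_flow \<Rightarrow> ('d \<Rightarrow> (real ^ 'm) \<Rightarrow>\<^sub>L 'd) \<Rightarrow>
     (real \<Rightarrow> 'd) \<Rightarrow> (real \<Rightarrow> 'd::euclidean_space) \<Rightarrow> bool" where
  "rough_integral_equation p X f Y \<kappa> \<longleftrightarrow>
     (\<exists>\<omega> \<theta>. control_function \<omega> \<and> \<theta> > 1 \<and>
        (\<forall>s t. 0 \<le> s \<and> s \<le> t \<and> t \<le> 1 \<longrightarrow>
           norm (Y t - Y s - (\<kappa> t - \<kappa> s)
             - (\<Sum>k = 1..nat \<lfloor>p\<rfloor>. \<Sum>w | length w = k. X s t w *\<^sub>R iterated_field f w (Y s)))
           \<le> \<omega> s t powr \<theta>))"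

text \<open>
  \<open>d\<kappa>\<^sub>t = 1\<^bsub>{Y\<^sub>t \<in> \<partial>D}\<^esub> n(Y\<^sub>t) |d\<kappa>\<^sub>t|\<close> as vector measures on \<open>[0, 1]\<close>, tested on the intervals
  \<open>(s, t]\<close>.
\<close>

definition reflection_condition ::
    "'d::euclidean_space set \<Rightarrow> (real \<Rightarrow> 'd) \<Rightarrow> (real \<Rightarrow> 'd) \<Rightarrow> bool" where
  "reflection_condition D Y \<kappa> \<longleftrightarrow>
     (\<forall>s t. 0 \<le> s \<and> s \<le> t \<and> t \<le> 1 \<longrightarrow>
        has_bochner_integral (variation_measure \<kappa>)
          (\<lambda>u. indicat_real {s<..t} u *\<^sub>R indicat_real (frontier D) (Y u) *\<^sub>R inner_normal D (Y u))
          (\<kappa> t - \<kappa> s))"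

definition reflected_RDE_solution ::
    "real \<Rightarrow> 'd::euclidean_space set \<Rightarrow> 'm::finite tensor_flow \<Rightarrow> ('d \<Rightarrow> (real ^ 'm) \<Rightarrow>\<^sub>L 'd) \<Rightarrow> 'd \<Rightarrow>
     (real \<Rightarrow> 'd) \<Rightarrow> (real \<Rightarrow> 'd) \<Rightarrow> bool" where
  "reflected_RDE_solution p D X f y\<^sub>0 Y \<kappa> \<longleftrightarrow>
     continuous_on {0..1} Y \<and> continuous_on {0..1} \<kappa> \<and>
     Y 0 = y\<^sub>0 \<and> \<kappa> 0 = 0 \<and>
     bounded_variation_01 \<kappa> \<and>
     (\<forall>t\<in>{0..1}. Y t \<in> D) \<and>
     reflection_condition D Y \<kappa> \<and>
     rough_integral_equation p X f Y \<kappa>"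

end

theory Submission
  imports Defs
begin

text \<open>
  In the half-space \<open>{y. 0 \<le> a \<bullet> y}\<close>, with \<open>c\<close> a unit vector orthogonal to \<open>a\<close>, let \<open>y = a \<bullet> Y\<close> and
  \<open>z = c \<bullet> Y\<close> and consider \<open>dy = z d\<beta> - d\<gamma> + dk\<close>, \<open>dz = y d\<beta>\<close>, started at the origin, where \<open>\<gamma>\<close>
  is increasing. The path resting at the origin is a solution, with \<open>k = \<gamma>\<close>. For a second one, suppose
  that \<open>z > 0\<close> is small and that \<open>\<beta>\<close> oscillates with amplitude \<open>A\<close>. While \<open>\<beta>\<close> increases, \<open>y\<close> leaves
  the boundary and becomes of order \<open>A z\<close>, so \<open>z\<close> gains a factor \<open>1 + C A\<^sup>2\<close>; then \<open>\<gamma>\<close> pushes \<open>y\<close>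
  back to \<open>0\<close>, and while \<open>\<beta>\<close> decreases the reflection keeps \<open>y = 0\<close>, so that \<open>z\<close> does not move. For
  \<open>p > 2\<close> a path of finite \<open>p\<close>-variation may oscillate near time \<open>0\<close> with \<open>\<Sum> A\<^sup>2 = \<infinity>\<close>, and then \<open>z\<close>
  grows from \<open>0\<close> to a positive value.

  We take \<open>\<beta> t = t\<^sup>n sin (t\<^sup>-\<^sup>m) / m\<close> with \<open>m = 2 n + 1\<close>, which is \<open>1 / p\<close>-Hoelder for large \<open>n\<close>, and
  prescribe \<open>y = \<eta> z\<close> with \<open>\<eta>\<close> proportional to \<open>t\<^sup>n\<close> times the squared positive part of the
  rescaled derivative of \<open>\<beta>\<close>; this determines \<open>z\<close>, \<open>k\<close> and \<open>\<gamma>\<close>. Since \<open>z\<close> is of order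
  \<open>exp (- C / t)\<close>, all estimates of the rough integral near the singular time \<open>0\<close> are trivial.
\<close>

section \<open>Real analysis\<close>

text \<open>The binomial theorem for divided powers amounts to Chen's relation for words that repeat
  a single letter. It is applied to the blocks of the letter \<open>j\<close> below.\<close>

lemma exp_binomial:
  fixes x y :: real
  shows "(x + y) ^ k / fact k = (\<Sum>q\<le>k. x ^ q / fact q * (y ^ (k - q) / fact (k - q)))"
proof -
  have "(x + y) ^ k / fact k = (\<Sum>q\<le>k. real (k choose q) * x ^ q * y ^ (k - q) / fact k)"
    by (simp add: binomial_ring sum_divide_distrib)
  also have "\<dots> = (\<Sum>q\<le>k. x ^ q / fact q * (y ^ (k - q) / fact (k - q)))"
    by (intro sum.cong refl) (simp add: binomial_fact field_simps)
  finally show ?thesis .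
qed

lemma DERIV_exp_term:
  assumes "(f has_real_derivative d) (at s)"
  shows "((\<lambda>s. f s ^ Suc m / fact (Suc m)) has_real_derivative d * (f s ^ m / fact m)) (at s)"
proof -
  have "((\<lambda>s. f s ^ Suc m / fact (Suc m)) has_real_derivative
      (1 + real m) * (d * f s ^ m) / fact (Suc m)) (at s)"
    by (intro DERIV_cdivide DERIV_power_Suc assms)
  moreover have "(1 + real m) * (d * f s ^ m) / fact (Suc m) = d * (f s ^ m / fact m)"
    by (simp add: fact_Suc divide_simps)
  ultimately show ?thesis by simp
qed

lemma has_real_derivative_sum_list:
  assumes "\<And>z. z \<in> set zs \<Longrightarrow> ((\<lambda>s. f z s) has_real_derivative f' z) F"
  shows "((\<lambda>s. \<Sum>z\<leftarrow>zs. f z s) has_real_derivative (\<Sum>z\<leftarrow>zs. f' z)) F"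
  using assms by (induction zs) (auto intro!: derivative_intros)

lemma continuous_on_sum_list:
  fixes f :: "'c \<Rightarrow> real \<Rightarrow> real"
  assumes "\<And>z. z \<in> set zs \<Longrightarrow> continuous_on S (f z)"
  shows "continuous_on S (\<lambda>s. \<Sum>z\<leftarrow>zs. f z s)"
  using assms by (induction zs) (auto intro!: continuous_intros)

text \<open>Squaring removes the corner of the positive part at \<open>0\<close>. This is why
  \<open>\<eta>\<close> below contains the square of \<open>qp\<close>.\<close>

lemma DERIV_pos_part_square:
  fixes f :: "real \<Rightarrow> real"
  assumes "(f has_real_derivative d) (at t)"
  shows "((\<lambda>t. (max 0 (f t))\<^sup>2) has_real_derivative 2 * max 0 (f t) * d) (at t)"
proof -
  have "((\<lambda>x :: real. (max 0 x)\<^sup>2) has_real_derivative 2 * max 0 x) (at x)" for x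
  proof (cases "x = 0")
    case True
    have "((\<lambda>y :: real. ((max 0 y)\<^sup>2 - (max 0 x)\<^sup>2) / (y - x)) \<longlongrightarrow> 0) (at x)"
    proof (rule Lim_null_comparison)
      show "\<forall>\<^sub>F y in at x. norm (((max 0 y)\<^sup>2 - (max 0 x)\<^sup>2) / (y - x)) \<le> \<bar>y\<bar>"
        by (rule always_eventually) (auto simp: True max_def power2_eq_square)
      show "((\<lambda>y. \<bar>y\<bar>) \<longlongrightarrow> 0) (at x)" unfolding True by (rule tendsto_rabs_zero) (rule tendsto_ident_at)
    qed
    then show ?thesis by (simp add: True has_field_derivative_iff)
  next
    case False
    show ?thesis
    proof (cases "x > 0")
      case True
      have "((\<lambda>x :: real. x\<^sup>2) has_real_derivative 2 * max 0 x) (at x)"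
        using True by (auto intro!: derivative_eq_intros)
      then show ?thesis
        by (rule has_field_derivative_transform_within_open[where S = "{0<..}"]) (use True in auto)
    next
      case neg: False
      have "((\<lambda>x :: real. 0) has_real_derivative 2 * max 0 x) (at x)"
        using neg by (auto intro!: derivative_eq_intros)
      then show ?thesis
        by (rule has_field_derivative_transform_within_open[where S = "{..<0}"]) (use neg False in auto)
    qed
  qed
  from DERIV_chain2[OF this assms] show ?thesis .
qed

text \<open>Deals with the singular time \<open>0\<close>: the linear bound squeezes the function
  there, whatever its oscillation.\<close>

lemma continuous_on_unit_interval:
  fixes f :: "real \<Rightarrow> real"
  assumes "f 0 = 0" and bound: "\<And>t. 0 < t \<Longrightarrow> t \<le> 1 \<Longrightarrow> \<bar>f t\<bar> \<le> C * t"
    and cont: "continuous_on {0<..1} f"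
  shows "continuous_on {0..1} f"
  unfolding continuous_on_eq_continuous_within
proof
  fix t :: real assume t: "t \<in> {0..1}"
  show "continuous (at t within {0..1}) f"
  proof (cases "t = 0")
    case True
    have "((\<lambda>x. f x) \<longlongrightarrow> 0) (at 0 within {0..1})"
    proof (rule Lim_null_comparison)
      show "\<forall>\<^sub>F x in at 0 within {0..1}. norm (f x) \<le> C * x"
        using bound by (auto simp: eventually_at_filter)
      have "((\<lambda>x. C * x) \<longlongrightarrow> C * 0) (at 0 within {0..1})" by (intro tendsto_intros)
      then show "((\<lambda>x. C * x) \<longlongrightarrow> 0) (at 0 within {0..1})" by simp
    qed
    then show ?thesis using assms(1) by (simp add: True continuous_within)
  next
    case False
    then have "t \<in> {0<..1}" using t by auto
    then have "(f \<longlongrightarrow> f t) (at t within {0<..1})" using cont by (auto simp: continuous_on_def)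
    moreover have "at t within {0<..1} = at t within {0..1}"
      by (rule at_within_nhd[of t "{0<..}"]) (use False t in auto)
    ultimately show ?thesis by (simp add: continuous_within)
  qed
qed

text \<open>One term of a series with nonnegative terms is below its sum. In \<open>Z_decay\<close>
  this turns \<open>exp (- c / t)\<close> into decay of every polynomial order.\<close>

lemma power_over_fact_le_exp:
  fixes x :: real assumes "0 \<le> x" shows "x ^ k / fact k \<le> exp x"
proof -
  have "x ^ k / fact k = (\<Sum>i\<in>{k}. x ^ i /\<^sub>R fact i)" by (simp add: field_simps)
  also have "\<dots> \<le> (\<Sum>i. x ^ i /\<^sub>R fact i)"
    using assms by (intro sum_le_suminf summable_exp_generic) auto
  finally show ?thesis by (simp add: exp_def)
qed

text \<open>
  Used to bound \<open>\<integral>rate\<close> from below: unlike the cube of the positive part, the quadratic has an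
  explicit average over one oscillation, and this average is positive.
\<close>

lemma pos_part_cube_lower:
  fixes x :: real assumes "\<bar>x\<bar> \<le> 2" shows "(8 * x\<^sup>2 + 15 * x - 2) / 30720 \<le> max 0 x ^ 3"
proof -
  have eq: "8 * x\<^sup>2 + 15 * x - 2 = (2 + x) * (8 * x - 1)" by (simp add: power2_eq_square algebra_simps)
  show ?thesis
  proof (cases "x \<le> 1 / 8")
    case True
    then have "(2 + x) * (8 * x - 1) \<le> 0" using assms by (intro mult_nonneg_nonpos) auto
    moreover have "0 \<le> max 0 x ^ 3" by simp
    ultimately show ?thesis unfolding eq by linarith
  next
    case False
    then have "(1 / 8) ^ 3 \<le> x ^ 3" by (intro power_mono) auto
    \<comment> \<open>Here \<open>4 * 15 / 30720 = (1 / 8) ^ 3\<close>, and the threshold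
      \<open>1 / 8\<close> is the positive root of the quadratic.\<close>
    moreover have "(2 + x) * (8 * x - 1) \<le> 4 * 15" using assms False by (intro mult_mono) auto
    ultimately show ?thesis unfolding eq using False by (simp add: power3_eq_cube max_def)
  qed
qed

lemma inverse_power_mono:
  fixes t :: real assumes "0 < t" "t \<le> 1" "k \<le> l" shows "1 / t ^ k \<le> 1 / t ^ l"
  using assms power_decreasing[of k l t] by (intro divide_left_mono) auto

lemma one_le_inverse_power: "0 < t \<Longrightarrow> t \<le> 1 \<Longrightarrow> 1 \<le> 1 / t ^ k" for t :: real
  by (simp add: power_le_one)

lemma abs_divide_power_le: "\<bar>x\<bar> \<le> c \<Longrightarrow> 0 < t \<Longrightarrow> \<bar>x / t ^ k\<bar> \<le> c / t ^ k" for x t :: real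
  using divide_right_mono[of "\<bar>x\<bar>" c "t ^ k"] by (simp only: abs_divide power_abs abs_of_pos zero_le_power less_imp_le)

lemma mono_on_indefinite_integral:
  fixes f :: "real \<Rightarrow> real"
  assumes "continuous_on {0..1} f" "\<And>t. 0 \<le> t \<Longrightarrow> t \<le> 1 \<Longrightarrow> 0 \<le> f t"
  shows "mono_on {0..1} (\<lambda>t. integral {0..t} f)"
proof (rule mono_onI)
  fix s t :: real assume st: "s \<in> {0..1}" "t \<in> {0..1}" "s \<le> t"
  have "f integrable_on {0..u}" if "u \<in> {0..1}" for u
    using that assms(1) by (intro integrable_continuous_interval) (auto elim: continuous_on_subset)
  then show "integral {0..s} f \<le> integral {0..t} f"
    using st assms(2) by (intro integral_subset_le) auto
qed

lemma continuous_indefinite_integral: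
  fixes f :: "real \<Rightarrow> real"
  assumes "continuous_on {0..1} f"
  shows "continuous_on {0..1} (\<lambda>t. integral {0..t} f)"
  using assms by (intro indefinite_integral_continuous_1 integrable_continuous_interval)

lemma deriv_indefinite_integral:
  fixes f :: "real \<Rightarrow> real"
  assumes "continuous_on {0..1} f" "0 < t" "t < 1"
  shows "((\<lambda>t. integral {0..t} f) has_real_derivative f t) (at t)"
  using integral_has_real_derivative[OF assms(1), of t] assms(2,3) by (simp add: at_within_Icc_at)

lemma indefinite_integral_locally_const:
  fixes f :: "real \<Rightarrow> real"
  assumes f: "continuous_on {0..1} f" and uv: "0 \<le> u" "u \<le> v" "v \<le> 1"
    and "\<And>x. u \<le> x \<Longrightarrow> x \<le> v \<Longrightarrow> f x = 0"
  shows "integral {0..v} f = integral {0..u} f"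
proof -
  have "f integrable_on {0..v}"
    using f uv by (intro integrable_continuous_interval) (auto elim: continuous_on_subset)
  then have "integral {0..v} f = integral {0..u} f + integral {u..v} f"
    using uv Henstock_Kurzweil_Integration.integral_combine[of 0 u v f] by simp
  moreover have "integral {u..v} f = integral {u..v} (\<lambda>x. 0)"
    using assms(5) by (intro Henstock_Kurzweil_Integration.integral_cong) auto
  ultimately show ?thesis by simp
qed

lemma exists_distinct: "2 \<le> CARD('a::finite) \<Longrightarrow> \<exists>x y :: 'a. x \<noteq> y"
  using card_le_Suc0_iff_eq[of "UNIV :: 'a set"] by auto

section \<open>The rough path over a drift and a Hoelder path\<close>

locale drift_lift =
  fixes b r :: "real \<Rightarrow> real" and i j :: "'m::finite"
  assumes ij: "i \<noteq> j"
    and cont_b: "continuous_on {0..1} b" and cont_r: "continuous_on {0..1} r"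
begin

text \<open>
  \<open>word_int w k s t\<close> is the iterated integral over \<open>[s, t]\<close> of the word \<open>w\<close> preceded by \<open>k\<close> letters \<open>j\<close>,
  along the path with components \<open>\<integral>r\<close> in direction \<open>i\<close> and \<open>b\<close> in direction \<open>j\<close>. Blocks of \<open>j\<close> are
  integrated in closed form, so that no integral against the rough path \<open>b\<close> is needed.
\<close>

primrec word_int :: "'m list \<Rightarrow> nat \<Rightarrow> real \<Rightarrow> real \<Rightarrow> real" where
  "word_int [] k s t = (b t - b s) ^ k / fact k"
| "word_int (l # w) k s t =
     (if l = j then word_int w (Suc k) s t
      else if l = i then integral {s..t} (\<lambda>u. (b u - b s) ^ k / fact k * (r u * word_int w 0 u t))
      else 0)"

text \<open>Separates the two occurrences of \<open>s\<close>, so that the integral can be differentiated in \<open>s\<close>.\<close>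

lemma integral_drift_expand:
  assumes "0 \<le> s" "s \<le> t" "t \<le> 1" and g: "continuous_on {0..t} g"
  shows "integral {s..t} (\<lambda>u. (b u - b s) ^ k / fact k * g u) =
      (\<Sum>q\<le>k. (- b s) ^ (k - q) / fact (k - q) * integral {s..t} (\<lambda>u. b u ^ q / fact q * g u))"
proof -
  have sub: "continuous_on {s..t} b" "continuous_on {s..t} g"
    using assms by (auto intro: continuous_on_subset[OF cont_b] continuous_on_subset[OF g])
  have "integral {s..t} (\<lambda>u. (b u - b s) ^ k / fact k * g u) =
      integral {s..t} (\<lambda>u. \<Sum>q\<le>k. (- b s) ^ (k - q) / fact (k - q) * (b u ^ q / fact q * g u))"
    using exp_binomial[of "b _" "- b s" k]
    by (simp add: sum_distrib_left sum_distrib_right mult_ac)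
  also have "\<dots> = (\<Sum>q\<le>k. (- b s) ^ (k - q) / fact (k - q) * integral {s..t} (\<lambda>u. b u ^ q / fact q * g u))"
    by (subst integral_sum)
      (auto intro!: integrable_continuous_interval continuous_intros sub)
  finally show ?thesis .
qed

section \<open>Regularity, size and Chen's relation of the iterated integrals\<close>

lemma continuous_word_int:
  assumes "t \<le> 1"
  shows "continuous_on {0..t} (\<lambda>s. word_int w k s t)"
proof (induction w arbitrary: k)
  case Nil
  show ?case
    using assms by (auto intro!: continuous_intros continuous_on_subset[OF cont_b])
next
  case (Cons l w)
  have b: "continuous_on {0..t} b" and r: "continuous_on {0..t} r"
    using assms cont_b cont_r by (auto elim: continuous_on_subset)
  define g where "g u = r u * word_int w 0 u t" for u
  have g: "continuous_on {0..t} g"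
    unfolding g_def by (intro continuous_intros r Cons.IH)
  have "continuous_on {0..t} (\<lambda>s. \<Sum>q\<le>k. (- b s) ^ (k - q) / fact (k - q) *
      integral {s..t} (\<lambda>u. b u ^ q / fact q * g u))"
    by (intro continuous_intros b indefinite_integral_continuous_1' integrable_continuous_interval g) auto
  then have "continuous_on {0..t} (\<lambda>s. integral {s..t} (\<lambda>u. (b u - b s) ^ k / fact k * g u))"
    using integral_drift_expand[OF _ _ assms g] by (subst continuous_on_cong[OF refl]) auto
  then show ?case
    using Cons.IH[of "Suc k"] ij by (cases "l = j"; cases "l = i") (simp_all add: g_def del: times_divide_eq_left)
qed

lemma continuous_integrand:
  assumes "0 \<le> s" "t \<le> 1" "s \<le> v" "v \<le> t"
  shows "continuous_on {s..v} (\<lambda>u. (b u - a) ^ k / fact k * (r u * word_int w 0 u t))"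
proof -
  have "continuous_on {s..v} b" "continuous_on {s..v} r" "continuous_on {s..v} (\<lambda>u. word_int w 0 u t)"
    using assms
    by (auto intro: continuous_on_subset[OF cont_b] continuous_on_subset[OF cont_r]
        continuous_on_subset[OF continuous_word_int])
  then show ?thesis by (auto intro!: continuous_intros)
qed

lemma integrable_integrand:
  assumes "0 \<le> s" "t \<le> 1" "s \<le> v" "v \<le> t"
  shows "(\<lambda>u. (b u - a) ^ k / fact k * (r u * word_int w 0 u t)) integrable_on {s..v}"
  by (intro integrable_continuous_interval continuous_integrand assms)

lemma word_int_drift_bound:
  assumes "0 \<le> s" "s \<le> t" "t \<le> 1" and B: "\<And>u. u \<in> {s..t} \<Longrightarrow> \<bar>(b u - b s) ^ k / fact k * (r u * word_int w 0 u t)\<bar> \<le> B"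
  shows "\<bar>word_int (i # w) k s t\<bar> \<le> B * (t - s)"
proof -
  have "norm (integral {s..t} (\<lambda>u. (b u - b s) ^ k / fact k * (r u * word_int w 0 u t))) \<le> B * (t - s)"
    by (rule integral_bound) (use assms in \<open>auto intro: continuous_integrand simp del: times_divide_eq_left\<close>)
  then show ?thesis using ij by simp
qed

text \<open>Each letter costs one factor \<open>\<Lambda>\<close>: a \<open>j\<close> through the
  oscillation of \<open>b\<close>, an \<open>i\<close> through the size of \<open>r\<close> times
  the length of the interval. The window from \<open>s0\<close> to \<open>t0\<close> stays fixed
  while the induction moves the lower endpoint \<open>s\<close>. Both the Hoelder and the Lipschitz
  estimates of \<open>X\<close> are instances.\<close>

lemma word_int_bound:
  assumes "0 \<le> s0" "t0 \<le> 1"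
    and b: "\<And>u v. u \<in> {s0..t0} \<Longrightarrow> v \<in> {s0..t0} \<Longrightarrow> \<bar>b u - b v\<bar> \<le> \<Lambda>"
    and r: "\<And>u. u \<in> {s0..t0} \<Longrightarrow> \<bar>r u\<bar> * (t0 - s0) \<le> \<Lambda>"
    and "s0 \<le> s" "s \<le> t" "t \<le> t0"
  shows "\<bar>word_int w k s t\<bar> \<le> \<Lambda> ^ (k + length w)"
  using \<open>s0 \<le> s\<close> \<open>s \<le> t\<close>
proof (induction w arbitrary: k s)
  case Nil
  have "\<bar>b t - b s\<bar> ^ k / fact k \<le> \<Lambda> ^ k / 1"
    using Nil assms fact_ge_1[of k] by (intro frac_le power_mono b zero_le_power) force+
  then show ?case by (simp add: power_abs)
next
  case (Cons l w)
  have \<Lambda>: "0 \<le> \<Lambda>" using b[of s s] Cons.prems assms by auto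
  consider "l = j" | "l = i" "l \<noteq> j" | "l \<noteq> i" "l \<noteq> j" by blast
  then show ?case
  proof cases
    case 1 then show ?thesis using Cons.IH[of s "Suc k"] Cons.prems by simp
  next
    case 2
    show ?thesis
    \<comment> \<open>The bound on \<open>r\<close> is used after division by
      \<open>t0 - s0\<close>, so a window of length zero is treated apart.\<close>
    proof (cases "s0 = t0")
      case True
      then have "s = t" using Cons.prems assms by simp
      then show ?thesis using 2 \<Lambda> by simp
    next
      case False
      then have pos: "0 < t0 - s0" using Cons.prems assms by simp
      have *: "\<bar>(b u - b s) ^ k / fact k * (r u * word_int w 0 u t)\<bar> * (t0 - s0) \<le> \<Lambda> ^ (k + length (l # w))"
        if u: "u \<in> {s..t}" for u
      proof -
        have 1: "\<bar>b u - b s\<bar> ^ k / fact k \<le> \<Lambda> ^ k / 1"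
          using u Cons assms fact_ge_1[of k] by (intro frac_le power_mono b zero_le_power) force+
        have 2: "\<bar>r u\<bar> * (t0 - s0) \<le> \<Lambda>" using u Cons.prems assms by (intro r) auto
        have 3: "\<bar>word_int w 0 u t\<bar> \<le> \<Lambda> ^ length w" using Cons.IH[of u 0] u Cons.prems by auto
        have "(\<bar>b u - b s\<bar> ^ k / fact k) * ((\<bar>r u\<bar> * (t0 - s0)) * \<bar>word_int w 0 u t\<bar>) \<le> \<Lambda> ^ k * (\<Lambda> * \<Lambda> ^ length w)"
          using 1 2 3 \<Lambda> Cons.prems assms by (intro mult_mono) auto
        then show ?thesis by (simp add: abs_mult power_abs power_add mult_ac)
      qed
      have "\<bar>word_int (i # w) k s t\<bar> \<le> \<Lambda> ^ (k + length (l # w)) / (t0 - s0) * (t - s)"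
        using * pos Cons.prems assms by (intro word_int_drift_bound) (auto simp: pos_le_divide_eq)
      also have "\<dots> \<le> \<Lambda> ^ (k + length (l # w)) / (t0 - s0) * (t0 - s0)"
        using \<Lambda> pos Cons.prems assms by (intro mult_left_mono) auto
      finally show ?thesis using pos 2 by simp
    qed
  next
    case 3 then show ?thesis using \<Lambda> by simp
  qed
qed

text \<open>The induction needs the form with a block of \<open>k\<close> letters \<open>j\<close>
  in front. A cut falls either inside or at the end of the block, which gives the first sum, or
  after at least one letter of \<open>w\<close>, which gives the second. The latter starts at
  \<open>q = 1\<close>, because the cut just after the block is already the term
  \<open>q = k\<close> of the first.\<close>

lemma word_int_Chen_aux:
  assumes "0 \<le> s" "s \<le> u" "u \<le> t" "t \<le> 1"
  shows "word_int w k s t = (\<Sum>q\<le>k. (b u - b s) ^ q / fact q * word_int w (k - q) u t) +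
    (\<Sum>q = 1..length w. word_int (take q w) k s u * word_int (drop q w) 0 u t)"
  using assms(1,2)
proof (induction w arbitrary: k s)
  case Nil
  show ?case using exp_binomial[of "b u - b s" "b t - b u" k] by simp
next
  case (Cons l w)
  have shift: "(\<Sum>q = 1..length (l # w). word_int (take q (l # w)) k s u * word_int (drop q (l # w)) 0 u t) =
     (\<Sum>q\<le>length w. word_int (l # take q w) k s u * word_int (drop q w) 0 u t)"
    by (rule sum.reindex_bij_witness[of _ Suc "\<lambda>q. q - 1"]) (auto simp: take_Cons' drop_Cons')
  consider "l = j" | "l = i" "l \<noteq> j" | "l \<noteq> i" "l \<noteq> j" by blast
  then show ?case
  proof cases
    case 1
    \<comment> \<open>The letter joins the block: the term \<open>q = 0\<close> of the shifted sum
      is the last term of the first sum in the induction hypothesis for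
      \<open>Suc k\<close>.\<close>
    have "{..length w} = insert 0 {1..length w}" by auto
    then show ?thesis
      unfolding shift using Cons.IH[OF Cons.prems, of "Suc k"] 1
      by (simp add: Suc_diff_le)
  next
    case 2
    \<comment> \<open>The outer integral is cut at \<open>u\<close>. Before \<open>u\<close> the
      induction hypothesis splits the inner integral; after \<open>u\<close> the binomial theorem
      moves the base point of the block from \<open>s\<close> to \<open>u\<close>.\<close>
    have "word_int (l # w) k s t = integral {s..u} (\<lambda>v. (b v - b s) ^ k / fact k * (r v * word_int w 0 v t)) +
       integral {u..t} (\<lambda>v. (b v - b s) ^ k / fact k * (r v * word_int w 0 v t))"
      using 2 Cons.prems assms
        Henstock_Kurzweil_Integration.integral_combine[of s u t "\<lambda>v. (b v - b s) ^ k / fact k * (r v * word_int w 0 v t)"]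
        integrable_integrand[of s t t "b s" k w]
      by (simp del: times_divide_eq_left)
    also have "integral {s..u} (\<lambda>v. (b v - b s) ^ k / fact k * (r v * word_int w 0 v t)) =
       integral {s..u} (\<lambda>v. \<Sum>q\<le>length w. ((b v - b s) ^ k / fact k * (r v * word_int (take q w) 0 v u)) * word_int (drop q w) 0 u t)"
    proof (rule Henstock_Kurzweil_Integration.integral_cong)
      fix v assume v: "v \<in> {s..u}"
      have "{..length w} = insert 0 {1..length w}" by auto
      then have "word_int w 0 v t = (\<Sum>q\<le>length w. word_int (take q w) 0 v u * word_int (drop q w) 0 u t)"
        using Cons.IH[of v 0] v Cons.prems by simp
      then show "(b v - b s) ^ k / fact k * (r v * word_int w 0 v t) =
        (\<Sum>q\<le>length w. ((b v - b s) ^ k / fact k * (r v * word_int (take q w) 0 v u)) * word_int (drop q w) 0 u t)"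
        by (simp add: sum_distrib_left mult_ac)
    qed
    also have "\<dots> = (\<Sum>q\<le>length w. word_int (l # take q w) k s u * word_int (drop q w) 0 u t)"
      using 2 Cons.prems assms
      by (subst integral_sum) (auto intro!: integrable_on_mult_left integrable_integrand simp del: times_divide_eq_left)
    also have "integral {u..t} (\<lambda>v. (b v - b s) ^ k / fact k * (r v * word_int w 0 v t)) =
      integral {u..t} (\<lambda>v. \<Sum>q\<le>k. (b u - b s) ^ q / fact q * ((b v - b u) ^ (k - q) / fact (k - q) * (r v * word_int w 0 v t)))"
    proof (rule Henstock_Kurzweil_Integration.integral_cong)
      fix v
      show "(b v - b s) ^ k / fact k * (r v * word_int w 0 v t) =
        (\<Sum>q\<le>k. (b u - b s) ^ q / fact q * ((b v - b u) ^ (k - q) / fact (k - q) * (r v * word_int w 0 v t)))"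
        using exp_binomial[of "b u - b s" "b v - b u" k] by (simp add: sum_distrib_right sum_distrib_left mult_ac)
    qed
    also have "\<dots> = (\<Sum>q\<le>k. (b u - b s) ^ q / fact q * word_int (l # w) (k - q) u t)"
      using 2 Cons.prems assms
      by (subst integral_sum) (auto intro!: integrable_on_mult_right integrable_integrand simp del: times_divide_eq_left)
    finally show ?thesis unfolding shift by simp
  next
    case 3 then show ?thesis unfolding shift by simp
  qed
qed

definition X :: "'m tensor_flow" where "X s t w = word_int w 0 s t"

lemma Chen:
  assumes "0 \<le> s" "s \<le> u" "u \<le> t" "t \<le> 1"
  shows "X s t w = (\<Sum>q\<le>length w. X s u (take q w) * X u t (drop q w))"
proof -
  have "{..length w} = insert 0 {1..length w}" by auto
  then show ?thesis
    unfolding X_def using word_int_Chen_aux[OF assms, of w 0] by simp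
qed

end

locale rough_drift_lift = drift_lift b r i j
  for b r :: "real \<Rightarrow> real" and i j :: "'m::finite" +
  fixes b' :: "real \<Rightarrow> real" and p H M :: real
  assumes p: "p > 2"
    and deriv_b: "\<And>t. 0 < t \<Longrightarrow> t < 1 \<Longrightarrow> (b has_real_derivative b' t) (at t)"
    and Hoelder_b: "\<And>s t. 0 \<le> s \<Longrightarrow> s \<le> t \<Longrightarrow> t \<le> 1 \<Longrightarrow> \<bar>b t - b s\<bar> \<le> H * (t - s) powr (1 / p)"
    and bound_r: "\<And>t. 0 \<le> t \<Longrightarrow> t \<le> 1 \<Longrightarrow> \<bar>r t\<bar> \<le> M"
begin

section \<open>Hoelder estimates for the lift\<close>

lemma H_nonneg: "0 \<le> H" using Hoelder_b[of 0 1] by simp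
lemma M_nonneg: "0 \<le> M" using bound_r[of 0] by simp

lemma le_powr_inverse:
  assumes "0 \<le> x" "x \<le> 1" shows "x \<le> x powr (1 / p)"
proof (cases "x = 0")
  case False
  then have "x powr 1 \<le> x powr (1 / p)" using assms p by (intro powr_mono') auto
  then show ?thesis using assms by simp
qed simp

lemma word_int_Hoelder:
  assumes "0 \<le> s" "s \<le> t" "t \<le> 1"
  shows "\<bar>word_int w k s t\<bar> \<le> ((H + M) * (t - s) powr (1 / p)) ^ (k + length w)"
proof (rule word_int_bound[OF assms(1,3) _ _ order.refl assms(2) order.refl])
  have osc: "\<bar>b v - b u\<bar> \<le> (H + M) * (t - s) powr (1 / p)" if "s \<le> u" "u \<le> v" "v \<le> t" for u v
  proof -
    have "\<bar>b v - b u\<bar> \<le> H * (v - u) powr (1 / p)" using that assms by (intro Hoelder_b) auto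
    also have "\<dots> \<le> (H + M) * (t - s) powr (1 / p)"
      using that assms p H_nonneg M_nonneg by (intro mult_mono powr_mono2) auto
    finally show ?thesis .
  qed
  show "\<bar>b u - b v\<bar> \<le> (H + M) * (t - s) powr (1 / p)" if "u \<in> {s..t}" "v \<in> {s..t}" for u v
    using osc[of u v] osc[of v u] that by (cases "u \<le> v") (auto simp: abs_minus_commute)
  show "\<bar>r u\<bar> * (t - s) \<le> (H + M) * (t - s) powr (1 / p)" if "u \<in> {s..t}" for u
    using that assms bound_r[of u] H_nonneg M_nonneg le_powr_inverse[of "t - s"]
    by (intro mult_mono) auto
qed

lemma X_Hoelder:
  assumes "0 \<le> s" "s \<le> t" "t \<le> 1"
  shows "\<bar>X s t w\<bar> \<le> ((H + M) * (t - s) powr (1 / p)) ^ length w"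
  unfolding X_def using word_int_Hoelder[OF assms, of w 0] by simp

lemma X_Nil [simp]: "X s t [] = 1"
  by (simp add: X_def)

definition driver :: "real \<Rightarrow> real ^ 'm" where
  "driver t = integral {0..t} r *\<^sub>R axis i 1 + b t *\<^sub>R axis j 1"

lemma integral_r_diff:
  assumes "0 \<le> s" "s \<le> t" "t \<le> 1"
  shows "integral {s..t} r = integral {0..t} r - integral {0..s} r"
  using assms Henstock_Kurzweil_Integration.integral_combine[of 0 s t r]
    integrable_continuous_interval[OF continuous_on_subset[OF cont_r, of "{0..t}"]] by auto

lemma X_singleton:
  assumes "0 \<le> s" "s \<le> t" "t \<le> 1"
  shows "X s t [l] = driver t $ l - driver s $ l"
  using ij integral_r_diff[OF assms] by (auto simp: X_def driver_def axis_def)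

text \<open>Differentiation in the lower endpoint strips one letter \<open>j\<close> from the front.
  When \<open>w\<close> begins with \<open>i\<close>, the integral is expanded so that
  \<open>s\<close> occurs only in the prefactors and in the limits of integration. The prefactors
  give the claim, while the contributions of the limits cancel.\<close>

lemma word_int_deriv:
  assumes "0 < s" "s < t" "t \<le> 1"
  shows "((\<lambda>s. word_int w (Suc k) s t) has_real_derivative - b' s * word_int w k s t) (at s)"
proof (induction w arbitrary: k)
  case Nil
  have "((\<lambda>s. b t - b s) has_real_derivative - b' s) (at s)"
    using assms by (auto intro!: derivative_eq_intros deriv_b)
  from DERIV_exp_term[OF this] show ?case by simp
next
  case (Cons l w)
  define g where "g u = r u * word_int w 0 u t" for u
  have bc: "continuous_on {0..t} b" using assms cont_b by (auto elim: continuous_on_subset)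
  have g: "continuous_on {0..t} g"
    unfolding g_def using assms cont_r
    by (intro continuous_intros continuous_word_int) (auto elim: continuous_on_subset)
  have int: "((\<lambda>s. integral {s..t} h) has_real_derivative - h s) (at s)"
    if h: "continuous_on {0..t} h" for h
    using integral_has_real_derivative'[OF h, of s] assms
    by (simp add: at_within_Icc_at)
  have drift: "((\<lambda>s. integral {s..t} (\<lambda>u. (b u - b s) ^ Suc k / fact (Suc k) * g u)) has_real_derivative
      - b' s * integral {s..t} (\<lambda>u. (b u - b s) ^ k / fact k * g u)) (at s)"
  proof (rule has_field_derivative_transform_within_open[where S = "{0<..<t}"])
    let ?I = "\<lambda>q s. integral {s..t} (\<lambda>u. b u ^ q / fact q * g u)"
    have I: "(?I q has_real_derivative - (b s ^ q / fact q * g s)) (at s)" for q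
      by (intro int continuous_intros bc g) auto
    have c: "((\<lambda>s. (- b s) ^ Suc m / fact (Suc m)) has_real_derivative
       (- b' s) * ((- b s) ^ m / fact m)) (at s)" for m
      using assms by (intro DERIV_exp_term DERIV_minus deriv_b) auto
    have "((\<lambda>s. (\<Sum>q\<le>k. (- b s) ^ Suc (k - q) / fact (Suc (k - q)) * ?I q s) + ?I (Suc k) s) has_real_derivative
       (\<Sum>q\<le>k. (- b' s) * ((- b s) ^ (k - q) / fact (k - q)) * ?I q s
          + - (b s ^ q / fact q * g s) * ((- b s) ^ Suc (k - q) / fact (Suc (k - q))))
         - (b s ^ Suc k / fact (Suc k) * g s)) (at s)"
      unfolding diff_conv_add_uminus by (intro DERIV_add DERIV_sum DERIV_mult c I)
    moreover have "(\<Sum>q\<le>k. (- b' s) * ((- b s) ^ (k - q) / fact (k - q)) * ?I q s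
          + - (b s ^ q / fact q * g s) * ((- b s) ^ Suc (k - q) / fact (Suc (k - q))))
         - (b s ^ Suc k / fact (Suc k) * g s) =
       - b' s * (\<Sum>q\<le>k. (- b s) ^ (k - q) / fact (k - q) * ?I q s)
        - g s * (\<Sum>q\<le>Suc k. b s ^ q / fact q * ((- b s) ^ (Suc k - q) / fact (Suc k - q)))"
      by (simp add: sum.distrib sum_subtractf sum_negf sum_distrib_left Suc_diff_le algebra_simps)
    \<comment> \<open>The contributions of the limits form the expansion of
      \<open>(b s - b s) ^ Suc k\<close>.\<close>
    moreover have "(\<Sum>q\<le>Suc k. b s ^ q / fact q * ((- b s) ^ (Suc k - q) / fact (Suc k - q))) = 0"
      using exp_binomial[of "b s" "- b s" "Suc k"] by simp
    moreover have "(\<Sum>q\<le>k. (- b s) ^ (k - q) / fact (k - q) * ?I q s) =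
        integral {s..t} (\<lambda>u. (b u - b s) ^ k / fact k * g u)"
      using assms by (intro integral_drift_expand[symmetric] g) auto
    ultimately show "((\<lambda>s. (\<Sum>q\<le>k. (- b s) ^ Suc (k - q) / fact (Suc (k - q)) * ?I q s) + ?I (Suc k) s) has_real_derivative
       - b' s * integral {s..t} (\<lambda>u. (b u - b s) ^ k / fact k * g u)) (at s)"
      by simp
    show "(\<Sum>q\<le>k. (- b x) ^ Suc (k - q) / fact (Suc (k - q)) * ?I q x) + ?I (Suc k) x =
       integral {x..t} (\<lambda>u. (b u - b x) ^ Suc k / fact (Suc k) * g u)" if "x \<in> {0<..<t}" for x
      using that assms by (subst integral_drift_expand[OF _ _ _ g]) (auto simp: Suc_diff_le)
  qed (use assms in auto)
  show ?case
    using Cons.IH[of "Suc k"] drift ij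
    by (cases "l = j"; cases "l = i") (simp_all add: g_def del: times_divide_eq_left power_Suc fact_Suc)
qed

section \<open>The shuffle relations, by differentiation in the lower endpoint\<close>

definition velocity :: "'m \<Rightarrow> real \<Rightarrow> real" where
  "velocity l s = (if l = j then b' s else if l = i then r s else 0)"

lemma X_deriv:
  assumes "0 < s" "s < t" "t \<le> 1"
  shows "((\<lambda>s. X s t (l # w)) has_real_derivative - velocity l s * X s t w) (at s)"
proof -
  have g: "continuous_on {0..t} (\<lambda>u. r u * word_int w 0 u t)"
    using assms cont_r by (intro continuous_intros continuous_word_int) (auto elim: continuous_on_subset)
  have "((\<lambda>s. integral {s..t} (\<lambda>u. r u * word_int w 0 u t)) has_real_derivative - (r s * word_int w 0 s t)) (at s)"
    using integral_has_real_derivative'[OF g, of s] assms by (simp add: at_within_Icc_at)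
  then show ?thesis
    using word_int_deriv[OF assms, of w 0] ij
    by (cases "l = j"; cases "l = i") (simp_all add: X_def velocity_def)
qed

lemma continuous_X_left:
  assumes "t \<le> 1" shows "continuous_on {0..t} (\<lambda>s. X s t w)"
  unfolding X_def by (rule continuous_word_int[OF assms])

lemma X_refl: "0 \<le> t \<Longrightarrow> t \<le> 1 \<Longrightarrow> X t t (l # w) = 0"
  using X_Hoelder[of t t "l # w"] by simp

text \<open>As a function of \<open>s\<close>, the difference of the two sides has derivative zero:
  the product rule strips the first letter of either word, just as the recursion of
  \<open>shuffle_list\<close> does, and the induction hypotheses apply. The difference vanishes at
  \<open>s = t\<close>, where all nonempty words do. Continuity covers the endpoint
  \<open>0\<close>, at which \<open>b\<close> need not be differentiable.\<close>

lemma shuffle: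
  assumes "0 \<le> s" "s \<le> t" "t \<le> 1"
  shows "X s t v * X s t w = (\<Sum>z\<leftarrow>shuffle_list v w. X s t z)"
  using assms(1,2)
proof (induction v w arbitrary: s rule: shuffle_list.induct)
  case (3 l u k v)
  define D where "D s = X s t (l # u) * X s t (k # v) - (\<Sum>z\<leftarrow>shuffle_list (l # u) (k # v). X s t z)" for s
  have "D s = D t"
  proof (cases "s = t")
    case False
    show ?thesis
    proof (rule DERIV_isconst_end[of s t D, symmetric])
      show "s < t" using False 3 by simp
      show "continuous_on {s..t} D"
        unfolding D_def using 3 assms
        by (intro continuous_intros continuous_on_sum_list continuous_on_subset[OF continuous_X_left]) auto
      fix y assume y: "s < y" "y < t"
      then have y': "0 < y" "0 \<le> y" "y \<le> t" using 3 by auto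
      have cons: "((\<lambda>s. \<Sum>z\<leftarrow>map ((#) a) zs. X s t z) has_real_derivative
          - velocity a y * (\<Sum>z\<leftarrow>zs. X y t z)) (at y)" for a zs
        using has_real_derivative_sum_list[of zs "\<lambda>z s. X s t (a # z)" "\<lambda>z. - velocity a y * X y t z" "at y"]
          X_deriv[of y t a] y y' assms
        by (simp add: o_def flip: sum_list_const_mult)
      have "(D has_real_derivative
         (- velocity l y * X y t u) * X y t (k # v) + (- velocity k y * X y t v) * X y t (l # u)
         - (- velocity l y * (\<Sum>z\<leftarrow>shuffle_list u (k # v). X y t z)
            + - velocity k y * (\<Sum>z\<leftarrow>shuffle_list (l # u) v. X y t z))) (at y)"
        unfolding D_def shuffle_list.simps map_append sum_list_append
        by (intro DERIV_diff DERIV_mult DERIV_add cons X_deriv) (use y y' assms in auto)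
      then show "(D has_real_derivative 0) (at y)"
        by (simp add: 3(1,2)[OF y'(2,3), symmetric] algebra_simps)
    qed
  qed simp
  also have "D t = 0"
    using 3 assms by (simp add: D_def X_refl o_def map_replicate_const sum_list_replicate)
  finally show ?case by (simp add: D_def)
qed simp_all

text \<open>In Chen's relation one of the two trivial cuts gives the term subtracted on the left.
  Each of the \<open>length w\<close> other terms contains a nonempty word over the short interval,
  hence a factor of Hoelder size.\<close>

lemma X_close_right:
  assumes "0 \<le> s" "s \<le> u" "u \<le> t" "t \<le> 1"
  shows "\<bar>X s t w - X s u w\<bar> \<le> length w * (H + M + 1) ^ (2 * length w) * (t - u) powr (1 / p)"
  and "\<bar>X s t w - X u t w\<bar> \<le> length w * (H + M + 1) ^ (2 * length w) * (u - s) powr (1 / p)"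
proof -
  let ?A = "H + M + 1"
  have A: "1 \<le> ?A" using H_nonneg M_nonneg by simp
  have big: "\<bar>X x y v\<bar> \<le> ?A ^ length w" if "0 \<le> x" "x \<le> y" "y \<le> 1" "length v \<le> length w" for x y v
  proof -
    have "(y - x) powr (1 / p) \<le> 1" using that p by (intro powr_le1) auto
    then have "(H + M) * (y - x) powr (1 / p) \<le> ?A * 1"
      using H_nonneg M_nonneg by (intro mult_mono) auto
    then have "\<bar>X x y v\<bar> \<le> ?A ^ length v"
      using X_Hoelder[OF that(1-3), of v] H_nonneg M_nonneg
      by (smt (verit) mult_nonneg_nonneg power_mono powr_ge_zero)
    also have "\<dots> \<le> ?A ^ length w" using that A by (intro power_increasing) auto
    finally show ?thesis .
  qed
  have small: "\<bar>X x y v\<bar> \<le> ?A ^ length w * (y - x) powr (1 / p)"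
    if "0 \<le> x" "x \<le> y" "y \<le> 1" "v \<noteq> []" "length v \<le> length w" for x y v
  proof -
    let ?h = "(y - x) powr (1 / p)"
    have h: "?h \<le> 1" using that p by (intro powr_le1) auto
    have "\<bar>X x y v\<bar> \<le> (?A * ?h) ^ length v"
      using X_Hoelder[OF that(1-3), of v] H_nonneg M_nonneg
      by (smt (verit) mult_nonneg_nonneg power_mono powr_ge_zero mult_right_mono)
    also have "\<dots> = ?A ^ length v * ?h ^ length v" by (rule power_mult_distrib)
    also have "\<dots> \<le> ?A ^ length w * ?h ^ 1"
      using that A h by (intro mult_mono power_increasing power_decreasing) (auto simp: Suc_le_eq)
    finally show ?thesis by simp
  qed
  have mid: "\<bar>\<Sum>q\<in>Q. X s u (take q w) * X u t (drop q w)\<bar> \<le> length w * ?A ^ (2 * length w) * h"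
    if "\<And>q. q \<in> Q \<Longrightarrow> \<bar>X s u (take q w)\<bar> * \<bar>X u t (drop q w)\<bar> \<le> ?A ^ length w * (?A ^ length w * h)"
      "card Q = length w" for Q h
  proof -
    have "\<bar>\<Sum>q\<in>Q. X s u (take q w) * X u t (drop q w)\<bar> \<le> (\<Sum>q\<in>Q. ?A ^ length w * (?A ^ length w * h))"
      using that(1) by (intro order.trans[OF sum_abs] sum_mono) (simp add: abs_mult)
    then show ?thesis using that(2) unfolding mult_2 power_add by (simp add: mult_ac)
  qed
  have split: "{..length w} = insert (length w) {..<length w}" "{..length w} = insert 0 {1..length w}" by auto
  have *: "X s t w - X s u w = (\<Sum>q\<in>{..<length w}. X s u (take q w) * X u t (drop q w))"
    using Chen[OF assms, of w] unfolding split(1) by simp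
  have **: "X s t w - X u t w = (\<Sum>q\<in>{1..length w}. X s u (take q w) * X u t (drop q w))"
    using Chen[OF assms, of w] unfolding split(2) by simp
  show "\<bar>X s t w - X s u w\<bar> \<le> length w * ?A ^ (2 * length w) * (t - u) powr (1 / p)"
    unfolding * by (rule mid) (use assms A in \<open>auto intro!: mult_mono big small\<close>)
  show "\<bar>X s t w - X u t w\<bar> \<le> length w * ?A ^ (2 * length w) * (u - s) powr (1 / p)"
    unfolding **
  proof (rule mid)
    fix q assume q: "q \<in> {1..length w}"
    have "\<bar>X u t (drop q w)\<bar> * \<bar>X s u (take q w)\<bar> \<le> ?A ^ length w * (?A ^ length w * (u - s) powr (1 / p))"
      using q assms A by (intro mult_mono big small) auto
    then show "\<bar>X s u (take q w)\<bar> * \<bar>X u t (drop q w)\<bar> \<le> ?A ^ length w * (?A ^ length w * (u - s) powr (1 / p))"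
      by (simp add: mult.commute)
  qed simp
qed

lemma continuous_X:
  "continuous_on {(s, t). 0 \<le> s \<and> s \<le> t \<and> t \<le> 1} (\<lambda>(s, t). X s t w)"
  unfolding continuous_on_def
proof (intro ballI)
  let ?T = "{(s :: real, t :: real). 0 \<le> s \<and> s \<le> t \<and> t \<le> 1}"
  let ?B = "length w * (H + M + 1) ^ (2 * length w)"
  fix z :: "real \<times> real" assume z: "z \<in> ?T"
  obtain s t where st: "z = (s, t)" "0 \<le> s" "s \<le> t" "t \<le> 1" using z by auto
  let ?h = "\<lambda>y. 2 * ?B * \<bar>fst y - s\<bar> powr (1 / p) + 2 * ?B * \<bar>snd y - t\<bar> powr (1 / p)"
  have B: "0 \<le> ?B" using H_nonneg M_nonneg by simp
  have "((\<lambda>y. (case y of (s, t) \<Rightarrow> X s t w) - X s t w) \<longlongrightarrow> 0) (at z within ?T)"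
  proof (rule Lim_null_comparison[of _ ?h])
    have "\<bar>X s' t' w - X s t w\<bar> \<le> ?h (s', t')" if "0 \<le> s'" "s' \<le> t'" "t' \<le> 1" for s' t'
    proof -
      \<comment> \<open>The two intervals are compared through their hull, one endpoint at a time.
        Each endpoint is moved twice, whence the factors 2 in \<open>?h\<close>.\<close>
      define s0 where "s0 = min s s'"
      define t0 where "t0 = max t t'"
      have le: "0 \<le> s0" "s0 \<le> s" "s0 \<le> s'" "t \<le> t0" "t' \<le> t0" "t0 \<le> 1"
        and abs: "s' - s0 \<le> \<bar>s' - s\<bar>" "s - s0 \<le> \<bar>s' - s\<bar>" "t0 - t' \<le> \<bar>t' - t\<bar>" "t0 - t \<le> \<bar>t' - t\<bar>"
        using that st by (auto simp: s0_def t0_def)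
      have 1: "\<bar>X s0 t' w - X s' t' w\<bar> \<le> ?B * (s' - s0) powr (1 / p)"
        "\<bar>X s0 t w - X s t w\<bar> \<le> ?B * (s - s0) powr (1 / p)"
        "\<bar>X s0 t0 w - X s0 t' w\<bar> \<le> ?B * (t0 - t') powr (1 / p)"
        "\<bar>X s0 t0 w - X s0 t w\<bar> \<le> ?B * (t0 - t) powr (1 / p)"
        using that st le by (auto intro!: X_close_right)
      have 2: "?B * (s' - s0) powr (1 / p) \<le> ?B * \<bar>s' - s\<bar> powr (1 / p)"
        "?B * (s - s0) powr (1 / p) \<le> ?B * \<bar>s' - s\<bar> powr (1 / p)"
        "?B * (t0 - t') powr (1 / p) \<le> ?B * \<bar>t' - t\<bar> powr (1 / p)"
        "?B * (t0 - t) powr (1 / p) \<le> ?B * \<bar>t' - t\<bar> powr (1 / p)"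
        using B p le abs by (intro mult_left_mono powr_mono2; simp)+
      show ?thesis using 1 2 unfolding fst_conv snd_conv by linarith
    qed
    then show "\<forall>\<^sub>F y in at z within ?T. norm ((case y of (s, t) \<Rightarrow> X s t w) - X s t w) \<le> ?h y"
      by (auto simp: eventually_at_filter intro!: always_eventually)
    have "((\<lambda>y. \<bar>fst y - s\<bar>) \<longlongrightarrow> \<bar>fst z - s\<bar>) (at z within ?T)" "((\<lambda>y. \<bar>snd y - t\<bar>) \<longlongrightarrow> \<bar>snd z - t\<bar>) (at z within ?T)"
      by (intro tendsto_intros)+
    then have lim: "((\<lambda>y. \<bar>fst y - s\<bar>) \<longlongrightarrow> 0) (at z within ?T)" "((\<lambda>y. \<bar>snd y - t\<bar>) \<longlongrightarrow> 0) (at z within ?T)"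
      using st by simp_all
    have "((\<lambda>y. \<bar>fst y - s\<bar> powr (1 / p)) \<longlongrightarrow> 0 powr (1 / p)) (at z within ?T)"
      "((\<lambda>y. \<bar>snd y - t\<bar> powr (1 / p)) \<longlongrightarrow> 0 powr (1 / p)) (at z within ?T)"
      by (rule tendsto_powr'[OF lim(1) tendsto_const], use p in simp)
        (rule tendsto_powr'[OF lim(2) tendsto_const], use p in simp)
    then have "(?h \<longlongrightarrow> 2 * ?B * 0 powr (1 / p) + 2 * ?B * 0 powr (1 / p)) (at z within ?T)"
      by (intro tendsto_add tendsto_mult_left)
    then show "(?h \<longlongrightarrow> 0) (at z within ?T)" by simp
  qed
  then show "((\<lambda>(s, t). X s t w) \<longlongrightarrow> (case z of (s, t) \<Rightarrow> X s t w)) (at z within ?T)"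
    by (simp add: st LIM_zero_cancel)
qed

text \<open>Level \<open>k\<close> is Hoelder of exponent \<open>k / p\<close>, so its power
  \<open>p / k\<close> is bounded by a multiple of the length of the interval, and lengths
  telescope.\<close>

lemma variation_X:
  assumes "k \<ge> 1"
  shows "bdd_above (variation_sums (p / k) (\<lambda>s t. level_norm k (X s t)) 0 1)"
proof -
  let ?N = "card {w :: 'm list. length w = k}"
  let ?C = "(?N * (H + M) ^ k) powr (p / k)"
  have fin: "finite {w :: 'm list. length w = k}"
    using finite_lists_length_eq[of "UNIV :: 'm set" k] by simp
  have step: "\<bar>level_norm k (X s t)\<bar> powr (p / k) \<le> ?C * (t - s)" if "0 \<le> s" "s \<le> t" "t \<le> 1" for s t
  proof -
    have "\<bar>level_norm k (X s t)\<bar> \<le> (\<Sum>w | length w = k. \<bar>X s t w\<bar>)"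
      unfolding level_norm_def using L2_set_le_sum_abs[of "X s t"] by (simp add: L2_set_nonneg)
    also have "\<dots> \<le> (\<Sum>w :: 'm list | length w = k. (H + M) ^ k * (t - s) powr (k / p))"
    proof (rule sum_mono)
      fix w :: "'m list" assume "w \<in> {w. length w = k}"
      then show "\<bar>X s t w\<bar> \<le> (H + M) ^ k * (t - s) powr (k / p)"
        using X_Hoelder[OF that, of w] 
        by (cases "s = t") (use assms in \<open>auto simp: power_mult_distrib powr_power zero_power\<close>)
    qed
    also have "\<dots> = ?N * (H + M) ^ k * (t - s) powr (k / p)" by simp
    finally have "\<bar>level_norm k (X s t)\<bar> powr (p / k) \<le> (?N * (H + M) ^ k * (t - s) powr (k / p)) powr (p / k)"
      using p by (intro powr_mono2) auto
    also have "\<dots> = ?C * (t - s)"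
      using that H_nonneg M_nonneg assms p by (simp add: powr_mult powr_powr)
    finally show ?thesis .
  qed
  show ?thesis
  proof (rule bdd_aboveI[of _ ?C])
    fix y assume "y \<in> variation_sums (p / k) (\<lambda>s t. level_norm k (X s t)) 0 1"
    then obtain n \<tau> where y: "y = (\<Sum>i<n. \<bar>level_norm k (X (\<tau> i) (\<tau> (Suc i)))\<bar> powr (p / k))"
      and \<tau>: "mono_on {..n} \<tau>" "\<tau> ` {..n} \<subseteq> {0..1}"
      by (auto simp: variation_sums_def)
    have "y \<le> (\<Sum>i<n. ?C * (\<tau> (Suc i) - \<tau> i))"
      unfolding y using \<tau> by (intro sum_mono step) (auto simp: image_subset_iff mono_on_def)
    also have "\<dots> = ?C * (\<tau> n - \<tau> 0)"
      by (simp add: sum_distrib_left[symmetric] sum_lessThan_telescope)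
    also have "\<dots> \<le> ?C * 1"
    proof (rule mult_left_mono)
      have "\<tau> n \<in> {0..1}" "\<tau> 0 \<in> {0..1}" using \<tau>(2) by auto
      then show "\<tau> n - \<tau> 0 \<le> 1" by auto
    qed simp
    finally show "y \<le> ?C" by simp
  qed
qed

lemma rough_path_X: "rough_path p driver X"
  unfolding rough_path_def
  by (intro conjI allI impI ballI X_Nil X_singleton Chen shuffle continuous_X variation_X) auto

text \<open>A leading \<open>i\<close> means that the outermost integration is against
  \<open>r\<close>, which gains a full factor \<open>t - s\<close>. With one further letter the
  total exponent exceeds 1, so such words are negligible even where their vector fields do not
  vanish.\<close>

lemma X_drift_bound:
  assumes "0 \<le> s" "s \<le> t" "t \<le> 1"
  shows "\<bar>X s t (i # w)\<bar> \<le> M * ((H + M) * (t - s) powr (1 / p)) ^ length w * (t - s)"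
  unfolding X_def
proof (rule word_int_drift_bound[OF assms])
  fix u assume u: "u \<in> {s..t}"
  have "\<bar>word_int w 0 u t\<bar> \<le> ((H + M) * (t - u) powr (1 / p)) ^ (0 + length w)"
    using u assms by (intro word_int_Hoelder) auto
  also have "\<dots> \<le> ((H + M) * (t - s) powr (1 / p)) ^ length w"
    using u assms p H_nonneg M_nonneg unfolding add_0 by (intro power_mono mult_left_mono powr_mono2) auto
  finally have "\<bar>r u\<bar> * \<bar>word_int w 0 u t\<bar> \<le> M * ((H + M) * (t - s) powr (1 / p)) ^ length w"
    using u assms bound_r[of u] M_nonneg by (intro mult_mono) auto
  then show "\<bar>(b u - b s) ^ 0 / fact 0 * (r u * word_int w 0 u t)\<bar> \<le> M * ((H + M) * (t - s) powr (1 / p)) ^ length w"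
    by (simp add: abs_mult)
qed

text \<open>Meant for intervals away from time \<open>0\<close>, where the oscillating path is
  Lipschitz with a constant that explodes polynomially as \<open>s\<close> tends to
  \<open>0\<close>.\<close>

lemma X_Lipschitz:
  assumes "0 \<le> s" "s \<le> t" "t \<le> 1" "0 \<le> L"
    and L: "\<And>u v. s \<le> u \<Longrightarrow> u \<le> v \<Longrightarrow> v \<le> t \<Longrightarrow> \<bar>b v - b u\<bar> \<le> L * (v - u)"
  shows "\<bar>X s t w\<bar> \<le> ((L + M) * (t - s)) ^ length w"
proof -
  have osc: "\<bar>b v - b u\<bar> \<le> (L + M) * (t - s)" if "s \<le> u" "u \<le> v" "v \<le> t" for u v
  proof -
    have "L * (v - u) \<le> (L + M) * (t - s)"
      using that assms M_nonneg by (intro mult_mono) auto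
    then show ?thesis using L[OF that] by simp
  qed
  have "\<bar>word_int w 0 s t\<bar> \<le> ((L + M) * (t - s)) ^ (0 + length w)"
  proof (rule word_int_bound[OF assms(1,3) _ _ order.refl assms(2) order.refl])
    show "\<bar>b u - b v\<bar> \<le> (L + M) * (t - s)" if "u \<in> {s..t}" "v \<in> {s..t}" for u v
      using osc[of u v] osc[of v u] that by (cases "u \<le> v") (auto simp: abs_minus_commute)
    show "\<bar>r u\<bar> * (t - s) \<le> (L + M) * (t - s)" if "u \<in> {s..t}" for u
      using that assms bound_r[of u] by (intro mult_right_mono) auto
  qed
  then show ?thesis by (simp add: X_def)
qed

end

section \<open>Reflection in a half-space\<close>

lemma Ck_on_affine:
  assumes "bounded_linear L" shows "Ck_on n S (\<lambda>x. L x + c)"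
  using assms
proof (induction n arbitrary: L c)
  case 0
  then show ?case by (simp add: linear_continuous_on continuous_on_add)
next
  case (Suc n)
  have der: "((\<lambda>x. L x + c) has_derivative L) (at x)" for x
    by (rule has_derivative_add_const[OF bounded_linear_imp_has_derivative[OF Suc.prems]])
  have "frechet_derivative (\<lambda>x. L x + c) (at x) = L" for x
    using frechet_derivative_at[OF der] by simp
  moreover have "Ck_on n S (\<lambda>x. L v)" for v
    using Suc.IH[OF bounded_linear_zero, of "L v"] by simp
  ultimately show ?case using differentiableI[OF der] by auto
qed

lemma smooth_on_affine: "bounded_linear L \<Longrightarrow> smooth_on S (\<lambda>x. L x + c)"
  by (simp add: smooth_on_def Ck_on_affine)

lemma local_defining_function_half_space:
  assumes "norm a = 1"
  shows "local_defining_function {x. 0 \<le> a \<bullet> x} y UNIV ((\<bullet>) a)" "GDERIV ((\<bullet>) a) y :> a"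
proof -
  have g: "GDERIV ((\<bullet>) a) x :> a" for x
    by (auto simp: gderiv_def inner_commute intro!: derivative_eq_intros)
  then show "GDERIV ((\<bullet>) a) y :> a" .
  have "smooth_on UNIV (\<lambda>x. a \<bullet> x + 0)" by (rule smooth_on_affine) (rule bounded_linear_inner_right)
  then show "local_defining_function {x. 0 \<le> a \<bullet> x} y UNIV ((\<bullet>) a)"
    using g assms unfolding local_defining_function_def by (auto intro!: exI[of _ a])
qed

lemma smooth_domain_half_space:
  fixes a :: "'a::euclidean_space"
  assumes "norm a = 1" shows "smooth_domain {x. 0 \<le> a \<bullet> x}"
  unfolding smooth_domain_def
proof (intro conjI exI)
  have a: "a \<noteq> 0" using assms by auto
  show "open {x. 0 < a \<bullet> x}" by (rule open_halfspace_gt)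
  show "connected {x. 0 < a \<bullet> x}" by (intro convex_connected convex_halfspace_gt)
  show "{x. 0 < a \<bullet> x} \<noteq> {}" using a by (auto intro!: exI[of _ a])
  show "{x. 0 \<le> a \<bullet> x} = closure {x. 0 < a \<bullet> x}" using closure_halfspace_gt[OF a, of 0] by simp
  show "\<forall>y\<in>frontier {x. 0 \<le> a \<bullet> x}. \<exists>V \<phi>. local_defining_function {x. 0 \<le> a \<bullet> x} y V \<phi>"
    using local_defining_function_half_space(1)[OF assms] by blast
qed

lemma frontier_half_space:
  fixes a :: "'a::euclidean_space"
  assumes "norm a = 1" shows "frontier {x. 0 \<le> a \<bullet> x} = {x. a \<bullet> x = 0}"
proof -
  have "a \<noteq> 0" using assms by auto
  then show ?thesis using frontier_halfspace_ge[of a 0] by simp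
qed

lemma inner_normal_half_space:
  fixes a :: "'a::euclidean_space"
  assumes "norm a = 1" "a \<bullet> y = 0" shows "inner_normal {x. 0 \<le> a \<bullet> x} y = a"
  using inner_normal_eqI[OF _ local_defining_function_half_space[OF assms(1)], of y] assms
  by (simp add: frontier_half_space sgn_div_norm)

section \<open>Variation measure and reflection for monotone pushes along the normal\<close>

lemma mono_path_variation:
  fixes a :: "'a::real_normed_vector"
  assumes K: "mono_on {s..t} K" and a: "norm a = 1" and "s \<le> t"
  shows "bdd_above (path_variation_sums (\<lambda>t. K t *\<^sub>R a) s t)"
    and "total_variation (\<lambda>t. K t *\<^sub>R a) s t = K t - K s"
proof -
  have norm: "norm (K v *\<^sub>R a - K u *\<^sub>R a) = \<bar>K v - K u\<bar>" for u v
    using a by (simp flip: scaleR_diff_left)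
  have le: "y \<le> K t - K s" if mem: "y \<in> path_variation_sums (\<lambda>t. K t *\<^sub>R a) s t" for y
  proof -
    obtain n \<tau> where y: "y = (\<Sum>i<n. \<bar>norm (K (\<tau> (Suc i)) *\<^sub>R a - K (\<tau> i) *\<^sub>R a)\<bar> powr 1)"
      and \<tau>: "mono_on {..n} \<tau>" "\<tau> ` {..n} \<subseteq> {s..t}"
      using mem unfolding variation_sums_def by blast
    have in_st: "\<tau> i \<in> {s..t}" if "i \<le> n" for i using \<tau>(2) that by auto
    have "\<bar>norm (K (\<tau> (Suc i)) *\<^sub>R a - K (\<tau> i) *\<^sub>R a)\<bar> powr 1 = K (\<tau> (Suc i)) - K (\<tau> i)" if "i < n" for i
    proof -
      have "K (\<tau> i) \<le> K (\<tau> (Suc i))"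
        using that in_st[of i] in_st[of "Suc i"] by (intro mono_onD[OF K] mono_onD[OF \<tau>(1)]) auto
      then show ?thesis by (simp add: norm)
    qed
    then have "y = (\<Sum>i<n. K (\<tau> (Suc i)) - K (\<tau> i))" 
      unfolding y by (intro sum.cong refl) (simp only: lessThan_iff)
    then have "y = K (\<tau> n) - K (\<tau> 0)" using sum_lessThan_telescope[of "\<lambda>i. K (\<tau> i)" n] by simp
    moreover have "K (\<tau> n) \<le> K t" "K s \<le> K (\<tau> 0)"
      using in_st[of n] in_st[of 0] assms by (auto intro!: mono_onD[OF K])
    ultimately show ?thesis by simp
  qed
  then show bdd: "bdd_above (path_variation_sums (\<lambda>t. K t *\<^sub>R a) s t)" by (rule bdd_aboveI)
  have "K s \<le> K t" using assms by (auto intro: mono_onD[OF K])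
  \<comment> \<open>The partition with the single interval from \<open>s\<close> to \<open>t\<close>
    attains the supremum.\<close>
  then have "K t - K s \<in> path_variation_sums (\<lambda>t. K t *\<^sub>R a) s t"
    unfolding variation_sums_def using assms(3)
    by (auto intro!: exI[of _ "1 :: nat"] exI[of _ "\<lambda>i :: nat. if i = 0 then s else t"] mono_onI simp: norm)
  then show "total_variation (\<lambda>t. K t *\<^sub>R a) s t = K t - K s"
    unfolding total_variation_def using le bdd by (intro antisym cSup_least cSup_upper) auto
qed

lemma bounded_variation_mono_path:
  assumes "mono_on {0..1} K" "norm a = 1"
  shows "bounded_variation_01 (\<lambda>t. K t *\<^sub>R a)"
  unfolding bounded_variation_01_def by (rule mono_path_variation(1)) (use assms in auto)

text \<open>By \<open>flat\<close>, the push is locally constant at all times when \<open>Y\<close>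
  is off the boundary, so its variation measure does not charge these times. As the normal is the
  constant \<open>a\<close>, the integral is then the whole mass of the interval times
  \<open>a\<close>.\<close>

lemma reflection_condition_half_space:
  fixes a :: "'a::euclidean_space" and K :: "real \<Rightarrow> real"
  assumes a: "norm a = 1" and K: "mono_on {0..1} K" "continuous_on {0..1} K"
    and Y: "continuous_on {0..1} Y"
    and flat: "\<And>u. 0 \<le> u \<Longrightarrow> u \<le> 1 \<Longrightarrow> a \<bullet> Y u \<noteq> 0 \<Longrightarrow>
      \<exists>e>0. \<forall>v. 0 \<le> v \<and> v \<le> 1 \<and> \<bar>v - u\<bar> < e \<longrightarrow> K v = K u"
  shows "reflection_condition {x. 0 \<le> a \<bullet> x} Y (\<lambda>t. K t *\<^sub>R a)"
  unfolding reflection_condition_def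
proof (intro allI impI)
  fix s t :: real assume st: "0 \<le> s \<and> s \<le> t \<and> t \<le> 1"
  \<comment> \<open>Clamping to the unit interval, as in \<open>variation_measure\<close>.\<close>
  define c where "c u = max 0 (min 1 u)" for u :: real
  have c: "0 \<le> c u" "c u \<le> 1" "\<bar>c u - c v\<bar> \<le> \<bar>u - v\<bar>" "u \<le> v \<Longrightarrow> c u \<le> c v" for u v
    by (auto simp: c_def)
  have c_id: "c u = u" if "0 \<le> u" "u \<le> 1" for u using that by (auto simp: c_def)
  define F where "F u = K (c u) - K 0" for u
  have "total_variation (\<lambda>t. K t *\<^sub>R a) 0 (c u) = F u" for u
    unfolding F_def using c(1,2) a by (intro mono_path_variation(2) monotone_on_subset[OF K(1)]) auto
  then have M: "variation_measure (\<lambda>t. K t *\<^sub>R a) = interval_measure F"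
    by (simp add: variation_measure_def c_def)
  have mono: "F x \<le> F y" if "x \<le> y" for x y
    using that c by (auto simp: F_def intro!: mono_onD[OF K(1)])
  have "continuous_on UNIV c" unfolding c_def by (intro continuous_intros)
  then have "continuous_on UNIV (\<lambda>x. K (c x))"
    using c by (intro continuous_on_compose2[OF K(2)]) auto
  then have "continuous_on UNIV F" unfolding F_def by (intro continuous_intros)
  then have cont: "continuous (at_right x) F" for x
    by (simp add: continuous_on_eq_continuous_at continuous_at_imp_continuous_at_within)
  have Ioc: "emeasure (interval_measure F) {x<..y} = ennreal (F y - F x)" if "x \<le> y" for x y
    by (rule emeasure_interval_measure_Ioc[OF that mono cont])
  define B where "B = {s<..t} \<inter> {u \<in> {0..1}. a \<bullet> Y u = 0}"
  have "closed ({0..1} \<inter> (\<lambda>u. a \<bullet> Y u) -` {0})"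
    by (intro continuous_closed_preimage continuous_intros Y)
  moreover have "{0..1} \<inter> (\<lambda>u. a \<bullet> Y u) -` {0} = {u \<in> {0..1}. a \<bullet> Y u = 0}" by auto
  ultimately have "{u \<in> {0..1}. a \<bullet> Y u = 0} \<in> sets borel" by simp
  then have B: "B \<in> sets borel" unfolding B_def by auto
  \<comment> \<open>Rational endpoints keep the union countable; each interval in it has measure
    \<open>F y - F x = 0\<close>.\<close>
  define N where "N = (\<Union>(x, y) \<in> {(x, y). x \<in> \<rat> \<and> y \<in> \<rat> \<and> x \<le> y \<and> F x = F y}. {x<..y})"
  have "countable {(x :: real, y). x \<in> \<rat> \<and> y \<in> \<rat> \<and> x \<le> y \<and> F x = F y}"
    by (rule countable_subset[of _ "\<rat> \<times> \<rat>"]) (auto intro: countable_SIGMA countable_rat)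
  then have N: "N \<in> null_sets (interval_measure F)"
    unfolding N_def by (rule null_sets_UN') (auto simp: null_sets_def Ioc)
  have sub: "{s<..t} - B \<subseteq> N"
  proof
    fix u assume u: "u \<in> {s<..t} - B"
    then have u01: "0 \<le> u" "u \<le> 1" "a \<bullet> Y u \<noteq> 0" using st by (auto simp: B_def)
    then obtain e where e: "e > 0" "\<And>v. 0 \<le> v \<Longrightarrow> v \<le> 1 \<Longrightarrow> \<bar>v - u\<bar> < e \<Longrightarrow> K v = K u"
      using flat[of u] by blast
    have F: "F v = F u" if "\<bar>v - u\<bar> < e" for v
      using that c(1,2)[of v] c(3)[of v u] c_id[of u] u01 e(2)[of "c v"] by (simp add: F_def)
    obtain x where x: "x \<in> \<rat>" "u - e < x" "x < u" using Rats_dense_in_real[of "u - e" u] e by auto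
    obtain y where y: "y \<in> \<rat>" "u < y" "y < u + e" using Rats_dense_in_real[of u "u + e"] e by auto
    have "F x = F y" using F[of x] F[of y] x y by simp
    then show "u \<in> N" unfolding N_def using x y by (intro UN_I[of "(x, y)"]) auto
  qed
  have "emeasure (interval_measure F) B = emeasure (interval_measure F) {s<..t}"
  proof -
    have "{s<..t} - B \<in> null_sets (interval_measure F)"
      using B by (intro null_sets_subset[OF N _ sub]) auto
    then have "emeasure (interval_measure F) ({s<..t} - ({s<..t} - B)) = emeasure (interval_measure F) {s<..t}"
      by (intro emeasure_Diff_null_set) auto
    moreover have "{s<..t} - ({s<..t} - B) = B" by (auto simp: B_def)
    ultimately show ?thesis by simp
  qed
  then have em: "emeasure (interval_measure F) B = ennreal (F t - F s)" using Ioc st by simp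
  then have "measure (interval_measure F) B = K t - K s"
    using mono[of s t] st by (simp add: measure_def F_def c_id)
  moreover have "has_bochner_integral (interval_measure F) (\<lambda>u. indicator B u *\<^sub>R a) (measure (interval_measure F) B *\<^sub>R a)"
    using B em by (intro has_bochner_integral_indicator) auto
  moreover have "indicat_real {s<..t} u *\<^sub>R indicat_real (frontier {x. 0 \<le> a \<bullet> x}) (Y u) *\<^sub>R inner_normal {x. 0 \<le> a \<bullet> x} (Y u) =
      indicator B u *\<^sub>R a" for u
    using st a by (auto simp: frontier_half_space B_def inner_normal_half_space indicator_def)
  ultimately show "has_bochner_integral (variation_measure (\<lambda>t. K t *\<^sub>R a))
      (\<lambda>u. indicat_real {s<..t} u *\<^sub>R indicat_real (frontier {x. 0 \<le> a \<bullet> x}) (Y u) *\<^sub>R inner_normal {x. 0 \<le> a \<bullet> x} (Y u))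
      (K t *\<^sub>R a - K s *\<^sub>R a)"
    unfolding M by (simp add: scaleR_diff_left)
qed

section \<open>The vector fields\<close>

text \<open>Direction \<open>j\<close> carries the linear field that exchanges the coordinates along
  \<open>a\<close> and \<open>c\<close>, direction \<open>i\<close> the constant field
  \<open>- a\<close>. Built from bounded linear combinators, the map is visibly affine in
  \<open>y\<close>, which makes its smoothness an instance of
  \<open>smooth_on_affine\<close>.\<close>

definition swap_drift_field ::
    "'m \<Rightarrow> 'm \<Rightarrow> 'd \<Rightarrow> 'd \<Rightarrow> 'd \<Rightarrow> (real ^ 'm) \<Rightarrow>\<^sub>L 'd::euclidean_space" where
  "swap_drift_field i j a c y =
     (blinfun_scaleR_left ((c \<bullet> y) *\<^sub>R a + (a \<bullet> y) *\<^sub>R c) o\<^sub>L blinfun_inner_left (axis j 1)) -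
     (blinfun_scaleR_left a o\<^sub>L blinfun_inner_left (axis i 1))"

lemma smooth_swap_drift_field: "smooth_on UNIV (swap_drift_field i j a c)"
proof -
  have "bounded_linear (\<lambda>y. (c \<bullet> y) *\<^sub>R a + (a \<bullet> y) *\<^sub>R c)"
    by (intro bounded_linear_add bounded_linear_scaleR_const bounded_linear_inner_right)
  then have "bounded_linear (\<lambda>y. blinfun_scaleR_left ((c \<bullet> y) *\<^sub>R a + (a \<bullet> y) *\<^sub>R c) o\<^sub>L blinfun_inner_left (axis j 1))"
    by (intro bounded_linear_compose[OF bounded_bilinear.bounded_linear_left[OF bounded_bilinear_blinfun_compose]]
        bounded_linear_compose[OF bounded_linear_blinfun_scaleR_left])
  from smooth_on_affine[OF this, of UNIV "- (blinfun_scaleR_left a o\<^sub>L blinfun_inner_left (axis i 1))"]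
  show ?thesis by (simp add: swap_drift_field_def[abs_def])
qed

lemma vector_field_swap_drift:
  assumes "i \<noteq> j"
  shows "vector_field (swap_drift_field i j a c) l y =
    (if l = j then (c \<bullet> y) *\<^sub>R a + (a \<bullet> y) *\<^sub>R c else if l = i then - a else 0)"
  using assms
  by (auto simp: vector_field_def swap_drift_field_def blinfun.bilinear_simps inner_axis_axis)

text \<open>The derivative of an affine map does not depend on the point, and it is applied to a
  linear, a constant or a zero field.\<close>

lemma iterated_field_affine:
  assumes "i \<noteq> j"
  shows "\<exists>L d. bounded_linear L \<and> iterated_field (swap_drift_field i j a c) w = (\<lambda>y. L y + d)"
proof (induction w)
  case Nil
  show ?case by (rule exI[of _ "\<lambda>y. y"], rule exI[of _ 0]) (simp add: bounded_linear_ident)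
next
  case (Cons l w)
  then obtain L d where L: "bounded_linear L" and eq: "iterated_field (swap_drift_field i j a c) w = (\<lambda>y. L y + d)"
    by blast
  have der: "((\<lambda>x. L x + d) has_derivative L) (at x)" for x
    by (rule has_derivative_add_const[OF bounded_linear_imp_has_derivative[OF L]])
  have D: "frechet_derivative (\<lambda>x. L x + d) (at x) = L" for x
    using frechet_derivative_at[OF der] by simp
  have A: "bounded_linear (\<lambda>y. L ((c \<bullet> y) *\<^sub>R a + (a \<bullet> y) *\<^sub>R c))"
    by (intro bounded_linear_compose[OF L] bounded_linear_add bounded_linear_scaleR_const bounded_linear_inner_right)
  have step: "iterated_field (swap_drift_field i j a c) (l # w) =
      (\<lambda>y. L (if l = j then (c \<bullet> y) *\<^sub>R a + (a \<bullet> y) *\<^sub>R c else if l = i then - a else 0))"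
    by (simp add: eq D vector_field_swap_drift[OF assms])
  show ?case
  proof (cases "l = j")
    case True
    then show ?thesis
      unfolding step by (intro exI[of _ "\<lambda>y. L ((c \<bullet> y) *\<^sub>R a + (a \<bullet> y) *\<^sub>R c)"] exI[of _ 0]) (simp add: A)
  next
    case False
    then show ?thesis
      unfolding step by (intro exI[of _ "\<lambda>y. 0"] exI[of _ "L (if l = i then - a else 0)"]) (simp add: bounded_linear_zero)
  qed
qed

text \<open>A leading \<open>j\<close> gives a linear field, which is small near the origin. A
  leading \<open>i\<close> gives a constant field, whose lack of smallness is made up for by
  \<open>X_drift_bound\<close>.\<close>

lemma iterated_field_bound:
  assumes ij: "i \<noteq> j"
  shows "\<exists>G\<ge>0. \<forall>y. norm (iterated_field (swap_drift_field i j a c) (j # w) y) \<le> G * norm y \<and>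
    norm (iterated_field (swap_drift_field i j a c) (i # w) y) \<le> G \<and>
    (\<forall>l. l \<noteq> i \<longrightarrow> l \<noteq> j \<longrightarrow> iterated_field (swap_drift_field i j a c) (l # w) y = 0)"
proof -
  obtain L d where L: "bounded_linear L" and eq: "iterated_field (swap_drift_field i j a c) w = (\<lambda>y. L y + d)"
    using iterated_field_affine[OF ij] by blast
  have der: "((\<lambda>x. L x + d) has_derivative L) (at x)" for x
    by (rule has_derivative_add_const[OF bounded_linear_imp_has_derivative[OF L]])
  have D: "frechet_derivative (\<lambda>x. L x + d) (at x) = L" for x
    using frechet_derivative_at[OF der] by simp
  have A: "bounded_linear (\<lambda>y. L ((c \<bullet> y) *\<^sub>R a + (a \<bullet> y) *\<^sub>R c))"
    by (intro bounded_linear_compose[OF L] bounded_linear_add bounded_linear_scaleR_const bounded_linear_inner_right)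
  then obtain G where G: "G > 0" "\<And>y. norm (L ((c \<bullet> y) *\<^sub>R a + (a \<bullet> y) *\<^sub>R c)) \<le> norm y * G"
    using bounded_linear.pos_bounded by blast
  show ?thesis
  proof (intro exI[of _ "G + norm (L (- a))"] conjI allI impI)
    fix y
    have "norm (L ((c \<bullet> y) *\<^sub>R a + (a \<bullet> y) *\<^sub>R c)) \<le> (G + norm (L (- a))) * norm y"
      using G(2)[of y] by (simp add: algebra_simps add_increasing2)
    then show "norm (iterated_field (swap_drift_field i j a c) (j # w) y) \<le> (G + norm (L (- a))) * norm y"
      by (simp add: eq D vector_field_swap_drift[OF ij])
    show "norm (iterated_field (swap_drift_field i j a c) (i # w) y) \<le> G + norm (L (- a))"
      using G(1) ij by (simp add: eq D vector_field_swap_drift[OF ij])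
    show "iterated_field (swap_drift_field i j a c) (l # w) y = 0" if "l \<noteq> i" "l \<noteq> j" for l
      using that L by (simp add: eq D vector_field_swap_drift[OF ij] linear_simps)
  qed (use G in auto)
qed

text \<open>Leaves two things to check: the first-level expansion and the longer words that begin
  with \<open>j\<close>. Words beginning with \<open>i\<close> are covered by
  \<open>X_drift_bound\<close>, and all others carry the zero field.\<close>

lemma (in rough_drift_lift) rough_integral_equationI:
  fixes Y \<kappa> :: "real \<Rightarrow> 'd::euclidean_space"
  assumes first: "\<And>s t. 0 \<le> s \<Longrightarrow> s \<le> t \<Longrightarrow> t \<le> 1 \<Longrightarrow>
      norm (Y t - Y s - (\<kappa> t - \<kappa> s) - (b t - b s) *\<^sub>R ((c \<bullet> Y s) *\<^sub>R a + (a \<bullet> Y s) *\<^sub>R c)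
        + integral {s..t} r *\<^sub>R a) \<le> C1 * (t - s)\<^sup>2"
    and higher: "\<And>w. 1 \<le> length w \<Longrightarrow> length w < nat \<lfloor>p\<rfloor> \<Longrightarrow> \<exists>C2. \<forall>s t. 0 \<le> s \<longrightarrow> s \<le> t \<longrightarrow> t \<le> 1 \<longrightarrow>
      \<bar>X s t (j # w)\<bar> * norm (Y s) \<le> C2 * (t - s)\<^sup>2"
  shows "rough_integral_equation p X (swap_drift_field i j a c) Y \<kappa>"
proof -
  let ?f = "swap_drift_field i j a c"
  let ?N = "nat \<lfloor>p\<rfloor>"
  \<comment> \<open>The exponent of a word beginning with \<open>i\<close>: 1 from the drift, and at
    least \<open>1 / p\<close> from the remaining letters. Quadratic errors are smaller, since
    \<open>?\<theta> \<le> 2\<close> and \<open>t - s \<le> 1\<close>.\<close>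
  let ?\<theta> = "1 + 1 / p"
  have theta: "1 < ?\<theta>" "?\<theta> \<le> 2" using p by auto
  have sq: "(t - s)\<^sup>2 \<le> (t - s) powr ?\<theta>" if "0 \<le> s" "s \<le> t" "t \<le> 1" for s t
  proof (cases "s = t")
    case False
    then have "(t - s) powr 2 \<le> (t - s) powr ?\<theta>" using that theta by (intro powr_mono') auto
    then show ?thesis using that False by (simp add: powr_numeral)
  qed simp
  have term_le: "\<exists>C. 0 \<le> C \<and> (\<forall>s t. 0 \<le> s \<longrightarrow> s \<le> t \<longrightarrow> t \<le> 1 \<longrightarrow>
      norm (X s t w *\<^sub>R iterated_field ?f w (Y s)) \<le> C * (t - s) powr ?\<theta>)"
    if w: "2 \<le> length w" "length w \<le> ?N" for w
  proof -
    obtain l v where lv: "w = l # v" "1 \<le> length v" "length v < ?N" using w by (cases w) auto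
    obtain G where G: "0 \<le> G"
      "\<And>y. norm (iterated_field ?f (j # v) y) \<le> G * norm y"
      "\<And>y. norm (iterated_field ?f (i # v) y) \<le> G"
      "\<And>y l. l \<noteq> i \<Longrightarrow> l \<noteq> j \<Longrightarrow> iterated_field ?f (l # v) y = 0"
      using iterated_field_bound[OF ij, of a c v] by blast
    consider "l = j" | "l = i" | "l \<noteq> i" "l \<noteq> j" by blast
    then show ?thesis
    proof cases
      case 1
      obtain C2 where C2: "\<And>s t. 0 \<le> s \<Longrightarrow> s \<le> t \<Longrightarrow> t \<le> 1 \<Longrightarrow> \<bar>X s t (j # v)\<bar> * norm (Y s) \<le> C2 * (t - s)\<^sup>2"
        using higher[OF lv(2,3)] by blast
      have C2_pos: "0 \<le> C2" using C2[of 0 1] by (smt (verit) abs_ge_zero norm_ge_zero mult_nonneg_nonneg one_power2 mult_cancel_left2 diff_zero)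
      have "norm (X s t w *\<^sub>R iterated_field ?f w (Y s)) \<le> (G * C2) * (t - s) powr ?\<theta>"
        if st: "0 \<le> s" "s \<le> t" "t \<le> 1" for s t
      proof -
        have "norm (X s t w *\<^sub>R iterated_field ?f w (Y s)) \<le> \<bar>X s t (j # v)\<bar> * (G * norm (Y s))"
          using G(2)[of "Y s"] by (simp add: lv 1 mult_left_mono del: iterated_field.simps)
        also have "\<dots> = G * (\<bar>X s t (j # v)\<bar> * norm (Y s))" by simp
        also have "\<dots> \<le> G * (C2 * (t - s) powr ?\<theta>)"
          using C2[OF st] sq[OF st] G(1) C2_pos
          by (intro mult_left_mono order.trans[OF C2[OF st]]) auto
        finally show ?thesis by simp
      qed
      then show ?thesis using G(1) C2_pos by (intro exI[of _ "G * C2"]) auto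
    next
      case 2
      let ?A = "(H + M) ^ length v"
      have "norm (X s t w *\<^sub>R iterated_field ?f w (Y s)) \<le> (M * ?A * G) * (t - s) powr ?\<theta>"
        if st: "0 \<le> s" "s \<le> t" "t \<le> 1" for s t
      proof -
        have h: "(t - s) powr (1 / p) \<le> 1" using st p by (intro powr_le1) auto
        have "\<bar>X s t (i # v)\<bar> \<le> M * ((H + M) * (t - s) powr (1 / p)) ^ length v * (t - s)"
          by (rule X_drift_bound[OF st])
        also have "\<dots> \<le> M * (?A * (t - s) powr (1 / p)) * (t - s)"
        proof -
          have "((t - s) powr (1 / p)) ^ length v \<le> ((t - s) powr (1 / p)) ^ 1"
            using lv h by (intro power_decreasing) auto
          then show ?thesis
            using M_nonneg H_nonneg st by (auto simp: power_mult_distrib intro!: mult_right_mono mult_left_mono)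
        qed
        also have "\<dots> = M * ?A * (t - s) powr ?\<theta>"
          using st by (simp add: powr_add)
        finally have "\<bar>X s t (i # v)\<bar> * norm (iterated_field ?f (i # v) (Y s)) \<le> M * ?A * (t - s) powr ?\<theta> * G"
          using G(3)[of "Y s"] M_nonneg H_nonneg by (intro mult_mono) auto
        then show ?thesis by (simp add: lv 2 mult_ac del: iterated_field.simps)
      qed
      then show ?thesis using G(1) M_nonneg H_nonneg by (intro exI[of _ "M * ?A * G"]) auto
    next
      case 3
      then show ?thesis using G(4) by (intro exI[of _ 0]) (simp add: lv del: iterated_field.simps)
    qed
  qed
  define c2 where "c2 w = (SOME C. 0 \<le> C \<and> (\<forall>s t. 0 \<le> s \<longrightarrow> s \<le> t \<longrightarrow> t \<le> 1 \<longrightarrow>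
      norm (X s t w *\<^sub>R iterated_field ?f w (Y s)) \<le> C * (t - s) powr ?\<theta>))" for w
  have c2: "0 \<le> c2 w" "\<And>s t. 0 \<le> s \<Longrightarrow> s \<le> t \<Longrightarrow> t \<le> 1 \<Longrightarrow>
      norm (X s t w *\<^sub>R iterated_field ?f w (Y s)) \<le> c2 w * (t - s) powr ?\<theta>"
    if w: "2 \<le> length w" "length w \<le> ?N" for w
    using someI_ex[OF term_le[OF w]] unfolding c2_def by blast+
  \<comment> \<open>The summand 1 ensures \<open>1 \<le> C\<close>, hence
    \<open>C \<le> C powr ?\<theta>\<close>, so that the constant can be moved into the control
    function.\<close>
  define C where "C = 1 + \<bar>C1\<bar> + (\<Sum>k = 2..?N. \<Sum>w | length w = k. c2 w)"
  have "0 \<le> (\<Sum>k = 2..?N. \<Sum>w | length w = k. c2 w)" by (intro sum_nonneg c2(1)) auto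
  then have C: "1 \<le> C" unfolding C_def by simp
  show ?thesis
    unfolding rough_integral_equation_def
  proof (intro exI[of _ "\<lambda>s t. C * (t - s)"] exI[of _ ?\<theta>] conjI allI impI)
    show "control_function (\<lambda>s t. C * (t - s))"
      unfolding control_function_def case_prod_unfold using C
      by (auto intro!: continuous_intros simp flip: distrib_left)
    show "?\<theta> > 1" by (rule theta)
    fix s t :: real assume "0 \<le> s \<and> s \<le> t \<and> t \<le> 1"
    then have st: "0 \<le> s" "s \<le> t" "t \<le> 1" by auto
    have N: "1 \<le> ?N" using p by linarith
    have words1: "{w :: 'm list. length w = 1} = range (\<lambda>l. [l])"
      by (auto simp: length_Suc_conv)
    have deriv_id: "frechet_derivative (\<lambda>y. y) (at x) = (\<lambda>y. y)" for x :: 'd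
      using frechet_derivative_ident by (simp add: id_def)
    have "(\<Sum>w | length w = 1. X s t w *\<^sub>R iterated_field ?f w (Y s)) =
       (\<Sum>l\<in>UNIV. X s t [l] *\<^sub>R vector_field ?f l (Y s))"
      unfolding words1 by (subst sum.reindex) (auto simp: inj_on_def deriv_id)
    also have "\<dots> = (\<Sum>l\<in>{i, j}. X s t [l] *\<^sub>R vector_field ?f l (Y s))"
      by (rule sum.mono_neutral_right) (auto simp: vector_field_swap_drift[OF ij])
    also have "\<dots> = (b t - b s) *\<^sub>R ((c \<bullet> Y s) *\<^sub>R a + (a \<bullet> Y s) *\<^sub>R c) - integral {s..t} r *\<^sub>R a"
      using ij by (simp add: vector_field_swap_drift[OF ij] X_def)
    finally have level1: "(\<Sum>w | length w = 1. X s t w *\<^sub>R iterated_field ?f w (Y s)) =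
      (b t - b s) *\<^sub>R ((c \<bullet> Y s) *\<^sub>R a + (a \<bullet> Y s) *\<^sub>R c) - integral {s..t} r *\<^sub>R a" .
    define R where "R = (\<Sum>k = 2..?N. \<Sum>w | length w = k. X s t w *\<^sub>R iterated_field ?f w (Y s))"
    have "norm R \<le> (\<Sum>k = 2..?N. \<Sum>w | length w = k. c2 w * (t - s) powr ?\<theta>)"
      unfolding R_def using st by (auto intro!: sum_norm_le c2(2))
    then have R: "norm R \<le> (\<Sum>k = 2..?N. \<Sum>w | length w = k. c2 w) * (t - s) powr ?\<theta>"
      by (simp add: sum_distrib_right)
    have "{1..?N} = insert 1 {2..?N}" using N by auto
    then have split: "(\<Sum>k = 1..?N. \<Sum>w | length w = k. X s t w *\<^sub>R iterated_field ?f w (Y s)) =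
       (\<Sum>w | length w = 1. X s t w *\<^sub>R iterated_field ?f w (Y s)) + R"
      unfolding R_def by simp
    have "norm (Y t - Y s - (\<kappa> t - \<kappa> s) - (\<Sum>k = 1..?N. \<Sum>w | length w = k. X s t w *\<^sub>R iterated_field ?f w (Y s)))
      \<le> norm (Y t - Y s - (\<kappa> t - \<kappa> s) - (b t - b s) *\<^sub>R ((c \<bullet> Y s) *\<^sub>R a + (a \<bullet> Y s) *\<^sub>R c)
        + integral {s..t} r *\<^sub>R a) + norm R"
      unfolding split level1 by (rule order.trans[OF _ norm_triangle_ineq4]) (simp add: algebra_simps)
    also have "\<dots> \<le> \<bar>C1\<bar> * (t - s) powr ?\<theta> + (\<Sum>k = 2..?N. \<Sum>w | length w = k. c2 w) * (t - s) powr ?\<theta>"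
    proof (rule add_mono[OF _ R])
      have "C1 * (t - s)\<^sup>2 \<le> \<bar>C1\<bar> * (t - s) powr ?\<theta>" using sq[OF st] by (intro mult_mono) auto
      then show "norm (Y t - Y s - (\<kappa> t - \<kappa> s) - (b t - b s) *\<^sub>R ((c \<bullet> Y s) *\<^sub>R a + (a \<bullet> Y s) *\<^sub>R c)
        + integral {s..t} r *\<^sub>R a) \<le> \<bar>C1\<bar> * (t - s) powr ?\<theta>"
        using first[OF st] by linarith
    qed
    also have "\<dots> \<le> C * (t - s) powr ?\<theta>" by (simp add: C_def algebra_simps)
    also have "\<dots> \<le> C powr ?\<theta> * (t - s) powr ?\<theta>"
      using C theta powr_mono[of 1 ?\<theta> C] by (intro mult_right_mono) auto
    also have "\<dots> = (C * (t - s)) powr ?\<theta>" using C st by (simp add: powr_mult)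
    finally show "norm (Y t - Y s - (\<kappa> t - \<kappa> s) - (\<Sum>k = 1..?N. \<Sum>w | length w = k. X s t w *\<^sub>R iterated_field ?f w (Y s)))
      \<le> (C * (t - s)) powr ?\<theta>" .
  qed
qed

section \<open>The oscillating path and the nontrivial solution\<close>

locale chirp =
  fixes n :: nat
  assumes n: "1 \<le> n"
begin

text \<open>Dividing by \<open>m\<close> in \<open>b\<close> makes \<open>- cos (phase t)\<close>,
  with amplitude 1, the leading part of \<open>q\<close>.\<close>

definition m :: real where "m = 2 * real n + 1"

lemma m: "3 \<le> m" "real n \<le> m / 2" "0 < m" "m \<noteq> 0"
  using n by (auto simp: m_def)

text \<open>
  \<open>b\<close> plays the role of \<open>\<beta>\<close>, with derivative \<open>b' = q / t ^ (n + 2)\<close>. The constant \<open>\<epsilon>\<close> is so small that the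
  density \<open>drift_density\<close> of \<open>\<gamma>\<close> below is nonnegative.
\<close>

definition phase :: "real \<Rightarrow> real" where "phase t = 1 / t ^ (2 * n + 1)"
definition b :: "real \<Rightarrow> real" where "b t = t ^ n * sin (phase t) / m"
definition q :: "real \<Rightarrow> real" where
  "q t = real n / m * t ^ (2 * n + 1) * sin (phase t) - cos (phase t)"
definition q' :: "real \<Rightarrow> real" where
  "q' t = real n * t ^ (2 * n) * sin (phase t) - real n * cos (phase t) / t - m * sin (phase t) / t ^ (2 * n + 2)"
definition b' :: "real \<Rightarrow> real" where "b' t = q t / t ^ (n + 2)"
definition qp :: "real \<Rightarrow> real" where "qp t = max 0 (q t)"
definition \<epsilon> :: real where "\<epsilon> = 1 / (10 * m)"
definition \<eta> :: "real \<Rightarrow> real" where "\<eta> t = \<epsilon> * t ^ n * (qp t)\<^sup>2"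
definition \<eta>' :: "real \<Rightarrow> real" where
  "\<eta>' t = \<epsilon> * (real n * t ^ (n - 1) * (qp t)\<^sup>2 + 2 * t ^ n * qp t * q' t)"
definition rate :: "real \<Rightarrow> real" where "rate t = \<epsilon> * qp t ^ 3 / t\<^sup>2"

section \<open>Derivatives and bounds for the oscillating path\<close>

lemma deriv_power: "((\<lambda>t. t ^ (2 * n + 1)) has_real_derivative m * t ^ (2 * n)) (at t)"
  using DERIV_power[OF DERIV_ident, of "2 * n + 1" t UNIV] by (simp add: m_def add.commute)

lemma power_split:
  fixes t :: real
  shows "t ^ (2 * n + 2) = t ^ n * t ^ (n + 2)" "t ^ (2 * n + 1) = t ^ (n - 1) * t ^ (n + 2)"
    "t ^ (2 * n + 1) * t ^ (2 * n + 1) = t ^ (2 * n) * t ^ (2 * n + 2)"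
    "t ^ (2 * n + 2) = t ^ (2 * n + 1) * t" "t ^ (n + 2) = t ^ n * t\<^sup>2"
proof -
  have eq: "2 * n + 2 = n + (n + 2)" "2 * n + 1 = (n - 1) + (n + 2)" "2 * n + 1 + (2 * n + 1) = 2 * n + (2 * n + 2)"
    using n by auto
  show "t ^ (2 * n + 2) = t ^ n * t ^ (n + 2)" "t ^ (2 * n + 1) = t ^ (n - 1) * t ^ (n + 2)"
    by (subst power_add[symmetric], metis eq)+
  show "t ^ (2 * n + 1) * t ^ (2 * n + 1) = t ^ (2 * n) * t ^ (2 * n + 2)"
    by (simp only: power_add[symmetric] eq(3))
  show "t ^ (2 * n + 2) = t ^ (2 * n + 1) * t" "t ^ (n + 2) = t ^ n * t\<^sup>2"
    by (simp_all add: power2_eq_square)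
qed

lemma deriv_phase:
  assumes "t \<noteq> 0"
  shows "(phase has_real_derivative - m / t ^ (2 * n + 2)) (at t)"
proof -
  have "(phase has_real_derivative (0 * t ^ (2 * n + 1) - 1 * (m * t ^ (2 * n))) / (t ^ (2 * n + 1) * t ^ (2 * n + 1))) (at t)"
    unfolding phase_def[abs_def] using assms by (intro DERIV_divide DERIV_const deriv_power) auto
  then show ?thesis unfolding power_split(3) using assms by simp
qed

lemma deriv_b:
  assumes "t \<noteq> 0"
  shows "(b has_real_derivative b' t) (at t)"
proof -
  have "(b has_real_derivative (real n * t ^ (n - 1) * sin (phase t) +
      cos (phase t) * (- m / t ^ (2 * n + 2)) * t ^ n) / m) (at t)"
    unfolding b_def[abs_def]
    using DERIV_power[OF DERIV_ident, of n t UNIV]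
    by (intro DERIV_cdivide DERIV_mult DERIV_fun_sin deriv_phase assms) simp
  moreover have "(real n * t ^ (n - 1) * sin (phase t) +
      cos (phase t) * (- m / t ^ (2 * n + 2)) * t ^ n) / m = b' t"
    unfolding b'_def q_def power_split(1,2) using assms m by (simp add: divide_simps del: power_Suc)
  ultimately show ?thesis by simp
qed

lemma deriv_q:
  assumes "t \<noteq> 0"
  shows "(q has_real_derivative q' t) (at t)"
proof -
  have "(q has_real_derivative (real n / m * (m * t ^ (2 * n))) * sin (phase t) +
      cos (phase t) * (- m / t ^ (2 * n + 2)) * (real n / m * t ^ (2 * n + 1)) -
      - sin (phase t) * (- m / t ^ (2 * n + 2))) (at t)"
    unfolding q_def[abs_def]
    by (intro DERIV_diff DERIV_mult DERIV_cmult deriv_power DERIV_fun_sin DERIV_fun_cos deriv_phase assms)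
  moreover have "(real n / m * (m * t ^ (2 * n))) * sin (phase t) +
      cos (phase t) * (- m / t ^ (2 * n + 2)) * (real n / m * t ^ (2 * n + 1)) -
      - sin (phase t) * (- m / t ^ (2 * n + 2)) = q' t"
  proof -
    have "real n / m * (m * U) * x + y * (- m / (S * t)) * (real n / m * S) - - x * (- m / (S * t)) =
        real n * U * x - real n * y / t - m * x / (S * t)" if "S \<noteq> 0" for S U x y :: real
      using m(4) that assms by (simp add: field_simps)
    then show ?thesis unfolding q'_def power_split(4) using assms by simp
  qed
  ultimately show ?thesis by simp
qed

lemma q_bound: "0 \<le> t \<Longrightarrow> t \<le> 1 \<Longrightarrow> \<bar>q t\<bar> \<le> 2"
proof -
  assume t: "0 \<le> t" "t \<le> 1"
  have "\<bar>real n / m * t ^ (2 * n + 1) * sin (phase t)\<bar> \<le> 1 * 1 * 1"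
    unfolding abs_mult using t m by (intro mult_mono) (auto simp: power_le_one abs_mult simp del: power_Suc power_add)
  then show ?thesis unfolding q_def using abs_cos_le_one[of "phase t"] by linarith
qed

lemma qp_bounds: "0 \<le> qp t" "0 \<le> t \<Longrightarrow> t \<le> 1 \<Longrightarrow> qp t \<le> 2"
  using q_bound[of t] by (auto simp: qp_def)

lemma q'_bound:
  assumes "0 < t" "t \<le> 1" shows "\<bar>q' t\<bar> \<le> 2 * m / t ^ (2 * n + 2)"
proof -
  define T where "T = 1 / t ^ (2 * n + 2)"
  have T: "1 \<le> T" "1 / t \<le> T"
    using assms one_le_inverse_power[of t "2 * n + 2"] inverse_power_mono[of t 1 "2 * n + 2"]
    by (auto simp: T_def simp del: power_Suc)
  have "\<bar>real n * t ^ (2 * n) * sin (phase t)\<bar> \<le> real n * 1 * 1"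
    unfolding abs_mult using assms by (intro mult_mono) (auto simp: power_le_one)
  also have "\<dots> \<le> real n * T" using mult_left_mono[OF T(1), of "real n"] by simp
  finally have 1: "\<bar>real n * t ^ (2 * n) * sin (phase t)\<bar> \<le> real n * T" .
  have "\<bar>real n * cos (phase t) / t\<bar> = real n * (\<bar>cos (phase t)\<bar> * (1 / t))" using assms by (simp add: abs_mult)
  also have "\<dots> \<le> real n * (1 * T)" using assms T by (intro mult_left_mono mult_mono) auto
  finally have 2: "\<bar>real n * cos (phase t) / t\<bar> \<le> real n * T" by simp
  have "\<bar>m * sin (phase t) / t ^ (2 * n + 2)\<bar> = m * (\<bar>sin (phase t)\<bar> * T)"
    using assms m by (simp add: abs_mult T_def)
  also have "\<dots> \<le> m * (1 * T)" using T m by (intro mult_left_mono mult_right_mono) auto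
  finally have 3: "\<bar>m * sin (phase t) / t ^ (2 * n + 2)\<bar> \<le> m * T" by simp
  have "\<bar>q' t\<bar> \<le> real n * T + real n * T + m * T"
    unfolding q'_def using 1 2 3 by (simp only: abs_le_iff) linarith
  also have "\<dots> = (2 * real n + m) * T" by (simp add: algebra_simps)
  also have "\<dots> \<le> 2 * m * T" using T m by (intro mult_right_mono) auto
  finally show ?thesis by (simp add: T_def)
qed

lemma \<epsilon>: "0 < \<epsilon>" "\<epsilon> \<le> 1 / 30" "\<epsilon> * m = 1 / 10"
  using m by (auto simp: \<epsilon>_def field_simps)

lemma b_bound: "0 \<le> t \<Longrightarrow> \<bar>b t\<bar> \<le> t ^ n"
proof -
  assume t: "0 \<le> t"
  have "\<bar>b t\<bar> = t ^ n * (\<bar>sin (phase t)\<bar> / m)" using t m by (simp add: b_def abs_mult)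
  also have "\<dots> \<le> t ^ n * (1 / 1)" using t m by (intro mult_left_mono frac_le) auto
  finally show ?thesis by simp
qed

lemma b'_bound: "0 < t \<Longrightarrow> t \<le> 1 \<Longrightarrow> \<bar>b' t\<bar> \<le> 2 / t ^ (n + 2)"
  unfolding b'_def by (intro abs_divide_power_le q_bound) auto

lemma b_Lipschitz:
  assumes "0 < s" "s \<le> u" "u \<le> v" "v \<le> 1"
  shows "\<bar>b v - b u\<bar> \<le> 2 / s ^ (n + 2) * (v - u)"
proof (cases "u = v")
  case False
  then have "u < v" using assms by simp
  moreover have "(b has_real_derivative b' x) (at x)" if "u \<le> x" for x
    using that assms by (intro deriv_b) auto
  ultimately obtain x where x: "u < x" "x < v" "b v - b u = (v - u) * b' x"
    using MVT2[of u v b b'] by blast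
  have pos: "0 < x" "s \<le> x" "x \<le> 1" using x assms by auto
  have "\<bar>b' x\<bar> \<le> 2 / x ^ (n + 2)" using pos by (intro b'_bound)
  also have "\<dots> \<le> 2 / s ^ (n + 2)"
    using pos assms(1) by (intro divide_left_mono power_mono mult_pos_pos zero_less_power) linarith+
  finally have "(v - u) * \<bar>b' x\<bar> \<le> (v - u) * (2 / s ^ (n + 2))"
    using assms by (intro mult_left_mono) auto
  then show ?thesis using assms unfolding x(3) abs_mult by (simp only: mult.commute abs_of_nonneg diff_ge_0_iff_ge)
qed (use assms in simp)

lemma \<eta>_bounds:
  assumes "0 \<le> t" "t \<le> 1" shows "0 \<le> \<eta> t" "\<eta> t \<le> 4 * \<epsilon>"
proof -
  show "0 \<le> \<eta> t" unfolding \<eta>_def using \<epsilon> assms by simp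
  have "\<epsilon> * t ^ n * (qp t)\<^sup>2 \<le> \<epsilon> * 1 * 2\<^sup>2"
    using assms \<epsilon> qp_bounds by (intro mult_mono power_mono) (auto simp: power_le_one)
  then show "\<eta> t \<le> 4 * \<epsilon>" by (simp add: \<eta>_def)
qed

lemma deriv_\<eta>:
  assumes "t \<noteq> 0" shows "(\<eta> has_real_derivative \<eta>' t) (at t)"
proof -
  have "((\<lambda>t. \<epsilon> * t ^ n) has_real_derivative \<epsilon> * (real n * t ^ (n - 1))) (at t)"
    using DERIV_power[OF DERIV_ident, of n t UNIV] by (intro DERIV_cmult) simp
  from DERIV_mult[OF this DERIV_pos_part_square[OF deriv_q[OF assms]]] show ?thesis
    by (simp add: \<eta>_def[abs_def] qp_def[abs_def] \<eta>'_def algebra_simps)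
qed

text \<open>Thanks to the square in \<open>\<eta>\<close>, a factor \<open>qp\<close> survives
  differentiation. The rest is at most \<open>5 * m / t ^ (n + 2)\<close>, and
  \<open>\<epsilon> * m = 1 / 10\<close> turns this into one half. The bound keeps
  \<open>drift_density\<close> nonnegative.\<close>

lemma \<eta>'_upper:
  assumes "0 < t" "t \<le> 1" shows "\<bar>\<eta>' t\<bar> \<le> qp t / (2 * t ^ (n + 2))"
proof -
  let ?T = "1 / t ^ (n + 2)"
  have pw: "t ^ n * (1 / t ^ (2 * n + 2)) = ?T"
    unfolding power_split(1) using assms by simp
  have "t ^ (n - 1) \<le> 1" using assms by (auto simp: power_le_one)
  then have T: "t ^ (n - 1) \<le> ?T" using one_le_inverse_power[OF assms, of "n + 2"] by linarith
  have "real n * t ^ (n - 1) * qp t \<le> real n * ?T * 2"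
    using T qp_bounds assms by (intro mult_mono) auto
  moreover have "\<bar>2 * t ^ n * q' t\<bar> \<le> 2 * t ^ n * (2 * m / t ^ (2 * n + 2))"
    unfolding abs_mult using q'_bound[OF assms] assms by (intro mult_mono) auto
  moreover have "2 * t ^ n * (2 * m / t ^ (2 * n + 2)) = 4 * m * ?T"
    unfolding pw[symmetric] by simp
  moreover have "0 \<le> real n * t ^ (n - 1) * qp t" using assms qp_bounds(1) by simp
  ultimately have "\<bar>real n * t ^ (n - 1) * qp t + 2 * t ^ n * q' t\<bar> \<le> real n * ?T * 2 + 4 * m * ?T"
    by linarith
  also have "\<dots> \<le> 5 * m * ?T" using assms m by (simp add: field_simps)
  finally have *: "\<bar>real n * t ^ (n - 1) * qp t + 2 * t ^ n * q' t\<bar> \<le> 5 * m * ?T" .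
  have "\<bar>\<eta>' t\<bar> = \<epsilon> * qp t * \<bar>real n * t ^ (n - 1) * qp t + 2 * t ^ n * q' t\<bar>"
  proof -
    have "\<eta>' t = (\<epsilon> * qp t) * (real n * t ^ (n - 1) * qp t + 2 * t ^ n * q' t)"
      by (simp add: \<eta>'_def power2_eq_square algebra_simps)
    then show ?thesis using \<epsilon>(1) qp_bounds(1)[of t] by (simp add: abs_mult)
  qed
  also have "\<dots> \<le> \<epsilon> * qp t * (5 * m * ?T)"
    using * \<epsilon> qp_bounds(1) by (intro mult_left_mono) auto
  also have "\<dots> = (\<epsilon> * m) * 5 * qp t * ?T" by simp
  also have "\<dots> = qp t / (2 * t ^ (n + 2))" unfolding \<epsilon>(3) by simp
  finally show ?thesis .
qed

text \<open>The equation dz = y d\<open>b\<close> with y = \<open>\<eta>\<close> z prescribes this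
  logarithmic derivative for z. The cube appears because \<open>qp\<close> vanishes where
  \<open>q\<close> is negative.\<close>

lemma rate_eq: "0 < t \<Longrightarrow> \<eta> t * b' t = rate t"
proof -
  assume "0 < t"
  moreover have "(qp t)\<^sup>2 * q t = qp t ^ 3" by (auto simp: qp_def max_def power2_eq_square power3_eq_cube)
  ultimately show ?thesis
    unfolding \<eta>_def b'_def rate_def power_split(5) by (simp add: mult_ac)
qed

lemma rate_bounds:
  assumes "0 < t" "t \<le> 1" shows "0 \<le> rate t" "rate t \<le> 1 / t\<^sup>2"
proof -
  show "0 \<le> rate t" using \<epsilon> qp_bounds(1) by (simp add: rate_def)
  have "\<epsilon> * qp t ^ 3 \<le> 1 / 30 * 2 ^ 3"
    using \<epsilon> qp_bounds assms by (intro mult_mono power_mono) auto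
  then show "rate t \<le> 1 / t\<^sup>2" unfolding rate_def by (intro divide_right_mono) auto
qed

lemma continuous_phase: "continuous_on {0<..} phase"
  unfolding phase_def[abs_def] by (auto intro!: continuous_intros)

lemma continuous_q: "continuous_on {0<..} q"
  unfolding q_def[abs_def] by (intro continuous_intros continuous_phase)

lemma continuous_q': "continuous_on {0<..} q'"
  unfolding q'_def[abs_def] by (intro continuous_intros continuous_phase) auto

lemma continuous_qp: "continuous_on {0<..} qp"
  unfolding qp_def[abs_def] by (intro continuous_intros continuous_q)

lemma continuous_\<eta>': "continuous_on {0<..} \<eta>'"
  unfolding \<eta>'_def[abs_def] by (intro continuous_intros continuous_qp continuous_q')

lemma continuous_\<eta>: "continuous_on {0<..} \<eta>"
  unfolding \<eta>_def[abs_def] by (intro continuous_intros continuous_qp)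

lemma continuous_rate: "continuous_on {0<..} rate"
  unfolding rate_def[abs_def] by (intro continuous_intros continuous_qp) auto

lemma continuous_b: "continuous_on {0..1} b"
proof (rule continuous_on_unit_interval[where C = 1])
  show "b 0 = 0" using n by (simp add: b_def)
  show "\<bar>b t\<bar> \<le> 1 * t" if "0 < t" "t \<le> 1" for t
    using b_bound[of t] power_decreasing[of 1 n t] n that by simp
  show "continuous_on {0<..1} b"
    by (rule continuous_on_subset[of "{0<..}"])
      (use m in \<open>auto simp: b_def[abs_def] intro!: continuous_intros continuous_phase\<close>)
qed


text \<open>\<open>q\<close> is a small perturbation of \<open>- cos (phase t)\<close>: the square
  of the perturbation is dropped, and the doubled cross term costs at most
  \<open>t ^ (2 * n + 1)\<close>.\<close>

lemma q_square_lower: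
  assumes "0 < t" "t \<le> 1" shows "(cos (phase t))\<^sup>2 - t ^ (2 * n + 1) \<le> (q t)\<^sup>2"
proof -
  let ?x = "real n / m * t ^ (2 * n + 1) * sin (phase t)"
  have "\<bar>?x\<bar> = real n / m * (t ^ (2 * n + 1) * \<bar>sin (phase t)\<bar>)"
    using assms m by (simp add: abs_mult)
  also have "\<dots> \<le> 1 / 2 * (t ^ (2 * n + 1) * 1)"
    using assms m by (intro mult_mono) (auto simp: field_simps)
  finally have "\<bar>?x\<bar> * \<bar>cos (phase t)\<bar> \<le> 1 / 2 * t ^ (2 * n + 1) * 1"
    using assms by (intro mult_mono) auto
  then have "?x * cos (phase t) \<le> 1 / 2 * t ^ (2 * n + 1)"
    unfolding abs_mult[symmetric] by linarith
  then show ?thesis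
    unfolding q_def power2_diff using zero_le_power2[of ?x] by linarith
qed

text \<open>An explicit function which, up to a constant factor and a bounded term, grows more slowly than \<open>\<integral>rate\<close>.\<close>

definition G :: "real \<Rightarrow> real" where
  "G t = - 2 / t - 2 / m * (t ^ (2 * n) * sin (2 * phase t)) + 15 * (t ^ n * b t)"

definition G' :: "real \<Rightarrow> real" where
  "G' t = 2 / t\<^sup>2 - 2 / m * (real (2 * n) * t ^ (2 * n - 1) * sin (2 * phase t)) + 4 * cos (2 * phase t) / t\<^sup>2
     + 15 * (real n * t ^ (n - 1) * b t) + 15 * q t / t\<^sup>2"

lemma deriv_G:
  assumes "t \<noteq> 0" shows "(G has_real_derivative G' t) (at t)"
proof -
  have 1: "((\<lambda>t. - 2 / t) has_real_derivative (0 * t - - 2 * 1) / (t * t)) (at t)"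
    using assms by (intro DERIV_divide DERIV_const DERIV_ident)
  have 2: "((\<lambda>t. t ^ (2 * n) * sin (2 * phase t)) has_real_derivative
      real (2 * n) * t ^ (2 * n - 1) * sin (2 * phase t) + cos (2 * phase t) * (2 * (- m / t ^ (2 * n + 2))) * t ^ (2 * n)) (at t)"
    using DERIV_power[OF DERIV_ident, of "2 * n" t UNIV]
    by (intro DERIV_mult DERIV_fun_sin DERIV_cmult deriv_phase assms) simp
  have 3: "((\<lambda>t. t ^ n * b t) has_real_derivative real n * t ^ (n - 1) * b t + b' t * t ^ n) (at t)"
    using DERIV_power[OF DERIV_ident, of n t UNIV]
    by (intro DERIV_mult deriv_b assms) simp
  have "t ^ (2 * n + 2) = t ^ (2 * n) * t\<^sup>2" by (simp add: power_add power2_eq_square)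
  then have 4: "cos (2 * phase t) * (2 * (- m / t ^ (2 * n + 2))) * t ^ (2 * n) = - (2 * m * cos (2 * phase t) / t\<^sup>2)"
    using assms by simp
  have 5: "b' t * t ^ n = q t / t\<^sup>2"
    unfolding b'_def power_split(5) using assms by simp
  have "(G has_real_derivative (0 * t - - 2 * 1) / (t * t)
      - 2 / m * (real (2 * n) * t ^ (2 * n - 1) * sin (2 * phase t) + - (2 * m * cos (2 * phase t) / t\<^sup>2))
      + 15 * (real n * t ^ (n - 1) * b t + q t / t\<^sup>2)) (at t)"
    unfolding G_def[abs_def] by (intro DERIV_add DERIV_diff DERIV_cmult 1 2[unfolded 4] 3[unfolded 5])
  moreover have "2 / m * (real (2 * n) * t ^ (2 * n - 1) * sin (2 * phase t) + - (2 * m * cos (2 * phase t) / t\<^sup>2)) =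
      2 / m * (real (2 * n) * t ^ (2 * n - 1) * sin (2 * phase t)) - 4 * cos (2 * phase t) / t\<^sup>2"
    using m by (simp add: distrib_left diff_divide_distrib)
  ultimately show ?thesis
    unfolding G'_def by (simp add: distrib_left power2_eq_square algebra_simps m(4))
qed

text \<open>Since \<open>8 * (cos x)\<^sup>2 - 2 = 2 + 4 * cos (2 * x)\<close>, the leading part of
  \<open>G'\<close> is the quadratic of \<open>pos_part_cube_lower\<close> at \<open>q t\<close>,
  divided by \<open>t\<^sup>2\<close>, up to bounded errors. Of the constant, 2 absorbs the sine
  term, 8 the error in \<open>q_square_lower\<close>, and \<open>15 * real n\<close> the term with
  \<open>b\<close>.\<close>

lemma rate_lower:
  assumes "0 < t" "t \<le> 1"
  shows "\<epsilon> / 30720 * (G' t - (10 + 15 * real n)) \<le> rate t"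
proof -
  let ?c = "cos (2 * phase t)"
  have p1: "0 \<le> t ^ k" "t ^ k \<le> 1" for k using assms by (auto simp: power_le_one)
  have "2 / m * (real (2 * n) * t ^ (2 * n - 1) * sin (2 * phase t)) \<ge> - 2"
  proof -
    have "\<bar>2 / m * (real (2 * n) * t ^ (2 * n - 1) * sin (2 * phase t))\<bar> =
        2 * (real (2 * n) / m) * (t ^ (2 * n - 1) * \<bar>sin (2 * phase t)\<bar>)"
      using m p1 by (simp add: abs_mult)
    also have "\<dots> \<le> 2 * 1 * (1 * 1)"
      using m p1 by (intro mult_mono) (auto simp: field_simps)
    finally show ?thesis by linarith
  qed
  moreover have "15 * (real n * t ^ (n - 1) * b t) \<le> 15 * real n"
  proof -
    have "\<bar>b t\<bar> \<le> 1" using b_bound[of t] p1[of n] assms by linarith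
    then have "\<bar>real n * t ^ (n - 1) * b t\<bar> \<le> real n * 1 * 1"
      unfolding abs_mult using p1 by (intro mult_mono) auto
    then show ?thesis by linarith
  qed
  moreover have "t ^ (2 * n + 1) / t\<^sup>2 \<le> 1"
  proof -
    have "t ^ (2 * n + 1) = t ^ (2 * n - 1) * t\<^sup>2"
      using n by (simp flip: power_add)
    then show ?thesis using assms p1 by simp
  qed
  ultimately have "G' t - (10 + 15 * real n) \<le> 2 / t\<^sup>2 + 4 * ?c / t\<^sup>2 + 15 * q t / t\<^sup>2 - 8 * (t ^ (2 * n + 1) / t\<^sup>2)"
    unfolding G'_def by linarith
  also have "\<dots> = (2 + 4 * ?c + 15 * q t - 8 * t ^ (2 * n + 1)) / t\<^sup>2"
    by (simp add: add_divide_distrib diff_divide_distrib)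
  also have "\<dots> \<le> (8 * (q t)\<^sup>2 + 15 * q t - 2) / t\<^sup>2"
    using q_square_lower[OF assms] by (intro divide_right_mono) (auto simp: cos_double_cos)
  also have "\<dots> \<le> 30720 * qp t ^ 3 / t\<^sup>2"
    using pos_part_cube_lower[of "q t"] q_bound[of t] assms by (intro divide_right_mono) (auto simp: qp_def)
  finally have "\<epsilon> / 30720 * (G' t - (10 + 15 * real n)) \<le> \<epsilon> / 30720 * (30720 * qp t ^ 3 / t\<^sup>2)"
    using \<epsilon>(1) by (intro mult_left_mono) auto
  then show ?thesis by (simp add: rate_def)
qed

text \<open>The tangential coordinate of the second solution. It is normalised at time 1, since the
  value \<open>0\<close> at time \<open>0\<close> does not determine it; continuity at
  \<open>0\<close> rests on the divergence of the integral of \<open>rate\<close>, made quantitative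
  in \<open>Z_decay\<close>.\<close>

definition Z :: "real \<Rightarrow> real" where
  "Z t = (if t \<le> 0 then 0 else exp (- integral {t..1} rate))"

lemma Z_0 [simp]: "Z 0 = 0" and Z_1 [simp]: "Z 1 = 1" by (simp_all add: Z_def)
lemma Z_nonneg: "0 \<le> Z t" by (simp add: Z_def)

lemma continuous_rate_Icc: "0 < s \<Longrightarrow> continuous_on {s..1} rate"
  by (rule continuous_on_subset[OF continuous_rate]) auto

lemma deriv_integral_rate:
  assumes "0 < t" "t < 1"
  shows "((\<lambda>t. - integral {t..1} rate) has_real_derivative rate t) (at t)"
proof -
  have "((\<lambda>t. integral {t..1} rate) has_real_derivative - rate t) (at t within {t / 2..1})"
    using assms by (intro integral_has_real_derivative' continuous_rate_Icc) auto
  moreover have "at t within {t / 2..1} = at t" using assms by (intro at_within_Icc_at) auto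
  ultimately show ?thesis using DERIV_minus by fastforce
qed

lemma deriv_Z:
  assumes "0 < t" "t < 1" shows "(Z has_real_derivative Z t * rate t) (at t)"
proof (rule has_field_derivative_transform_within_open[where S = "{0<..}"])
  show "((\<lambda>t. exp (- integral {t..1} rate)) has_real_derivative Z t * rate t) (at t)"
    using DERIV_fun_exp[OF deriv_integral_rate[OF assms]] assms by (simp add: Z_def)
qed (use assms in \<open>auto simp: Z_def\<close>)

text \<open>Comparison with \<open>G\<close> bounds the exponent of \<open>Z\<close> by a constant
  minus \<open>2 * \<delta> / t\<close>, and such an exponential beats every power of
  \<open>t\<close>.\<close>

lemma Z_decay: "\<exists>C\<ge>0. \<forall>t. 0 \<le> t \<longrightarrow> t \<le> 1 \<longrightarrow> Z t \<le> C * t ^ k"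
proof -
  define c where "c = 10 + 15 * real n"
  define \<delta> where "\<delta> = \<epsilon> / 30720"
  have \<delta>: "0 < \<delta>" using \<epsilon>(1) by (simp add: \<delta>_def)
  \<comment> \<open>Apart from \<open>- 2 / t\<close>, the terms of \<open>G t\<close> add up to at
    most 16, so 17 leaves room.\<close>
  define A where "A = \<delta> * (17 + c - G 1)"
  have log_Z: "- integral {t..1} rate \<le> \<delta> * (- 2 / t) + A" if t: "0 < t" "t \<le> 1" for t
  proof -
    \<comment> \<open>Nondecreasing by \<open>rate_lower\<close>; its values at \<open>t\<close> and
      at \<open>1\<close> are compared.\<close>
    let ?f = "\<lambda>u. - integral {u..1} rate - \<delta> * (G u - c * u)"
    have "?f t \<le> ?f 1"
    proof (rule DERIV_nonneg_imp_increasing_open[OF t(2)])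
      fix u assume u: "t < u" "u < 1"
      have "(?f has_real_derivative rate u - \<delta> * (G' u - c * 1)) (at u)"
        using u t by (intro DERIV_diff DERIV_cmult deriv_integral_rate deriv_G DERIV_ident) auto
      moreover have "0 \<le> rate u - \<delta> * (G' u - c * 1)"
        using rate_lower[of u] u t by (simp add: \<delta>_def c_def)
      ultimately show "\<exists>y. (?f has_real_derivative y) (at u) \<and> 0 \<le> y" by blast
    next
      have "continuous_on {t..1} G"
        using t by (intro continuous_at_imp_continuous_on ballI DERIV_isCont[OF deriv_G]) auto
      then show "continuous_on {t..1} ?f"
        using t by (intro continuous_intros indefinite_integral_continuous_1' integrable_continuous_interval continuous_rate_Icc)
    qed
    then have "- integral {t..1} rate \<le> \<delta> * (G t - c * t) - \<delta> * (G 1 - c)" by simp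
    also have "\<dots> = \<delta> * (G t - c * t - G 1 + c)" by (simp add: algebra_simps)
    also have "\<dots> \<le> \<delta> * (- 2 / t + 17 - G 1 + c)"
    proof (rule mult_left_mono)
      have p1: "0 \<le> t ^ j" "t ^ j \<le> 1" for j using t by (auto simp: power_le_one)
      have "\<bar>2 / m * (t ^ (2 * n) * sin (2 * phase t))\<bar> = 2 / m * (t ^ (2 * n) * \<bar>sin (2 * phase t)\<bar>)"
        using m p1 by (simp add: abs_mult)
      also have "\<dots> \<le> 1 * (1 * 1)" using m p1 by (intro mult_mono) (auto simp: field_simps)
      finally have "- (2 / m * (t ^ (2 * n) * sin (2 * phase t))) \<le> 1" by linarith
      moreover have "t ^ n * b t \<le> 1"
      proof -
        have "\<bar>b t\<bar> \<le> 1" using b_bound[of t] p1[of n] t by linarith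
        then have "\<bar>t ^ n\<bar> * \<bar>b t\<bar> \<le> 1 * 1" using p1 by (intro mult_mono) auto
        then show ?thesis unfolding abs_mult[symmetric] by linarith
      qed
      moreover have "0 \<le> c * t" using t by (simp add: c_def)
      ultimately show "G t - c * t - G 1 + c \<le> - 2 / t + 17 - G 1 + c" unfolding G_def by linarith
    qed (use \<delta> in simp)
    also have "\<dots> = \<delta> * (- 2 / t) + A" by (simp add: A_def algebra_simps)
    finally show ?thesis .
  qed
  let ?C = "exp A * (fact k / (2 * \<delta>) ^ k)"
  have "Z t \<le> ?C * t ^ k" if t: "0 < t" "t \<le> 1" for t
  proof -
    have "Z t \<le> exp (A - 2 * \<delta> / t)" using log_Z[OF t] t by (simp add: Z_def mult.commute)
    also have "\<dots> = exp A / exp (2 * \<delta> / t)" by (rule exp_diff)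
    also have "\<dots> \<le> exp A / ((2 * \<delta> / t) ^ k / fact k)"
      using t \<delta> by (intro divide_left_mono power_over_fact_le_exp) auto
    also have "\<dots> = ?C * t ^ k" using t \<delta> by (simp add: power_divide power_mult_distrib)
    finally show ?thesis .
  qed
  moreover have "Z 0 \<le> ?C * 0 ^ k" using \<delta> by simp
  ultimately have "\<forall>t. 0 \<le> t \<longrightarrow> t \<le> 1 \<longrightarrow> Z t \<le> ?C * t ^ k"
    using order_le_less by metis
  moreover have "0 \<le> ?C" using \<delta> by simp
  ultimately show ?thesis by blast
qed

lemma continuous_Z_pos: "continuous_on {0<..1} Z"
proof -
  have "continuous_on {s..1} Z" if "0 < s" for s
  proof -
    have "continuous_on {s..1} (\<lambda>t. exp (- integral {t..1} rate))"
      using that by (intro continuous_intros indefinite_integral_continuous_1' integrable_continuous_interval continuous_rate_Icc)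
    then show ?thesis using that by (subst continuous_on_cong[OF refl]) (auto simp: Z_def)
  qed
  note cont = this
  show ?thesis
    unfolding continuous_on_eq_continuous_within
  proof
    fix t :: real assume t: "t \<in> {0<..1}"
    then have "continuous (at t within {t / 2..1}) Z"
      using cont[of "t / 2"] by (auto simp: continuous_on_eq_continuous_within)
    moreover have "at t within {t / 2..1} = at t within {0<..1}"
      by (rule at_within_nhd[of t "{t / 2<..}"]) (use t in auto)
    ultimately show "continuous (at t within {0<..1}) Z" by (simp add: continuous_within)
  qed
qed

text \<open>The decay of \<open>Z\<close> absorbs any polynomial explosion at time \<open>0\<close>
  and still leaves a prescribed power of \<open>t\<close>.\<close>

lemma Z_times_bound:
  assumes f: "\<And>t. 0 < t \<Longrightarrow> t \<le> 1 \<Longrightarrow> \<bar>f t\<bar> \<le> c / t ^ l" and "0 \<le> c"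
  shows "\<exists>C\<ge>0. \<forall>t. 0 < t \<longrightarrow> t \<le> 1 \<longrightarrow> \<bar>Z t * f t\<bar> \<le> C * t ^ k"
proof -
  obtain C where C: "0 \<le> C" "\<And>t. 0 \<le> t \<Longrightarrow> t \<le> 1 \<Longrightarrow> Z t \<le> C * t ^ (k + l)"
    using Z_decay[of "k + l"] by blast
  have "\<bar>Z t * f t\<bar> \<le> C * c * t ^ k" if t: "0 < t" "t \<le> 1" for t
  proof -
    have "\<bar>Z t\<bar> * \<bar>f t\<bar> \<le> (C * t ^ (k + l)) * (c / t ^ l)"
      using t f[OF t] C Z_nonneg[of t] by (intro mult_mono) auto
    also have "\<dots> = C * c * t ^ k" using t by (simp add: power_add)
    finally show ?thesis by (simp add: abs_mult)
  qed
  then show ?thesis using C(1) assms(2) by (intro exI[of _ "C * c"]) auto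
qed

lemma continuous_Z_times:
  assumes f: "\<And>t. 0 < t \<Longrightarrow> t \<le> 1 \<Longrightarrow> \<bar>f t\<bar> \<le> c / t ^ l" and "0 \<le> c" and "continuous_on {0<..} f"
  shows "continuous_on {0..1} (\<lambda>t. Z t * f t)"
proof -
  obtain C where C: "\<And>t. 0 < t \<Longrightarrow> t \<le> 1 \<Longrightarrow> \<bar>Z t * f t\<bar> \<le> C * t ^ 1"
    using Z_times_bound[OF f assms(2), of 1] by blast
  have "continuous_on {0<..1} f" by (rule continuous_on_subset[OF assms(3)]) auto
  then show ?thesis
    using C by (intro continuous_on_unit_interval[where C = C] continuous_intros continuous_Z_pos) auto
qed

text \<open>The second hypothesis says \<open>1 / p \<le> real n / (2 * n + 2)\<close>. If
  \<open>s \<le> t / 2\<close>, the increment of time is comparable to \<open>t\<close>, and the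
  bound on the amplitude suffices; otherwise its length is compared with the local time scale of
  oscillation.\<close>

lemma b_Hoelder:
  assumes p: "0 < p" "2 * real n + 2 \<le> real n * p" and "0 \<le> s" "s \<le> t" "t \<le> 1"
  shows "\<bar>b t - b s\<bar> \<le> 2 ^ (n + 3) * (t - s) powr (1 / p)"
proof (cases "s = t")
  case False
  define h where "h = t - s"
  \<comment> \<open>The phase has speed \<open>m / t ^ (2 * n + 2)\<close>, so an oscillation near
    \<open>t\<close> takes a time of order \<open>t ^ (2 * n + 2)\<close>. The amplitude
    \<open>t ^ n\<close> is the power \<open>\<mu>\<close> of this scale.\<close>
  define \<mu> where "\<mu> = real n / (2 * n + 2)"
  have h: "0 < h" "h \<le> 1" using assms False by (auto simp: h_def)
  have t: "0 < t" using assms False by auto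
  have \<mu>: "0 < \<mu>" "\<mu> \<le> 1" "1 / p \<le> \<mu>" "1 - \<mu> = real (n + 2) / (2 * n + 2)"
    using n p by (auto simp: \<mu>_def field_simps)
  have pw: "(t ^ (2 * n + 2)) powr x = t powr (real (2 * n + 2) * x)" for x
    by (simp only: powr_realpow[OF t, symmetric] powr_powr)
  have h\<mu>: "h powr \<mu> \<le> h powr (1 / p)" "h \<le> h powr (1 / p)"
    using h \<mu> powr_mono'[of "1 / p" \<mu> h] powr_mono'[of "1 / p" 1 h] by auto
  have big: "c * x \<le> 2 ^ (n + 3) * h powr (1 / p)" if "0 \<le> x" "x \<le> h powr (1 / p)" "0 \<le> c" "c \<le> 2 ^ (n + 3)" for c x
    using that by (intro mult_mono) auto
  have p8: "(8 :: real) \<le> 2 ^ (n + 3)" by (simp add: power_add)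
  have crude: "\<bar>b t - b s\<bar> \<le> 2 * t ^ n"
    using b_bound[of t] b_bound[of s] power_mono[of s t n] assms by linarith
  have "\<bar>b t - b s\<bar> \<le> 2 ^ (n + 3) * h powr (1 / p)"
  proof (cases "s \<le> t / 2")
    case True
    have "t ^ n \<le> t" using power_decreasing[of 1 n t] n assms by simp
    then have "\<bar>b t - b s\<bar> \<le> 4 * h" using crude True by (simp add: h_def)
    also have "\<dots> \<le> 2 ^ (n + 3) * h powr (1 / p)" using h h\<mu> p8 by (intro big) auto
    finally show ?thesis .
  next
    case s: False
    show ?thesis
    proof (cases "t ^ (2 * n + 2) \<le> h")
      case True
      have "t ^ n = (t ^ (2 * n + 2)) powr \<mu>"
        unfolding pw by (simp add: \<mu>_def powr_realpow[OF t])
      also have "\<dots> \<le> h powr \<mu>" using True t \<mu> by (intro powr_mono2) auto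
      finally have "\<bar>b t - b s\<bar> \<le> 2 * h powr (1 / p)" using crude h\<mu> by linarith
      also have "\<dots> \<le> 2 ^ (n + 3) * h powr (1 / p)" using h h\<mu> p8 by (intro big) auto
      finally show ?thesis .
    next
      case False
      \<comment> \<open>Increments shorter than an oscillation: \<open>h powr (1 - \<mu>)\<close> is
        traded for \<open>t ^ (n + 2)\<close>, which cancels the Lipschitz constant.\<close>
      have "h = h powr \<mu> * h powr (1 - \<mu>)" using h by (simp flip: powr_add)
      also have "\<dots> \<le> h powr \<mu> * (t ^ (2 * n + 2)) powr (1 - \<mu>)"
        using False h \<mu> by (intro mult_left_mono powr_mono2) auto
      also have "(t ^ (2 * n + 2)) powr (1 - \<mu>) = t ^ (n + 2)"
        unfolding \<mu>(4) pw using powr_realpow[OF t, of "n + 2"] by simp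
      finally have *: "h / t ^ (n + 2) \<le> h powr \<mu>" using t by (simp add: pos_divide_le_eq)
      \<comment> \<open>As \<open>s\<close> exceeds \<open>t / 2\<close>, the Lipschitz constant may
        be taken at \<open>t / 2\<close>; hence the factor \<open>2 * 2 ^ (n + 2)\<close>.\<close>
      have "\<bar>b t - b s\<bar> \<le> 2 / (t / 2) ^ (n + 2) * (t - s)"
        using b_Lipschitz[of "t / 2" s t] s t assms by auto
      also have "\<dots> = 2 ^ (n + 3) * (h / t ^ (n + 2))"
        using t by (simp add: h_def power_divide power_add)
      also have "\<dots> \<le> 2 ^ (n + 3) * h powr (1 / p)" using * h\<mu> by (intro mult_left_mono) auto
      finally show ?thesis .
    qed
  qed
  then show ?thesis by (simp add: h_def)
qed simp

text \<open>
  The factor \<open>t ^ (n + 2)\<close> in the bound on \<open>g'\<close> compensates the explosion of \<open>b'\<close> at \<open>0\<close>.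
\<close>

lemma second_order_remainder:
  assumes P: "continuous_on {0..1} P" "\<And>t. 0 < t \<Longrightarrow> t < 1 \<Longrightarrow> (P has_real_derivative g t * b' t) (at t)"
    and g: "continuous_on {0..1} g" "\<And>t. 0 < t \<Longrightarrow> t < 1 \<Longrightarrow> (g has_real_derivative g' t) (at t)"
    and g'_le: "\<And>t. 0 < t \<Longrightarrow> t < 1 \<Longrightarrow> \<bar>g' t\<bar> \<le> C * t ^ (n + 2)"
    and "0 \<le> C" "0 \<le> s" "s \<le> t" "t \<le> 1"
  shows "\<bar>P t - P s - (b t - b s) * g s\<bar> \<le> 2 * C * (t - s)\<^sup>2"
proof (cases "s = t")
  case False
  then have st: "s < t" using assms by simp
  let ?Q = "\<lambda>u. P u - (b u - b s) * g s"
  have contQ: "continuous_on {s..t} ?Q"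
    using assms by (intro continuous_intros)
      (auto intro: continuous_on_subset[OF P(1)] continuous_on_subset[OF continuous_b])
  have dQ: "(?Q has_real_derivative (g u - g s) * b' u) (at u)" if u: "s < u" "u < t" for u
  proof -
    have "(?Q has_real_derivative g u * b' u - (b' u - 0) * g s) (at u)"
      using u assms by (intro DERIV_diff DERIV_cmult_right P(2) deriv_b DERIV_const) auto
    then show ?thesis by (simp add: algebra_simps)
  qed
  obtain u where u: "s < u" "u < t" "?Q t - ?Q s = (t - s) * ((g u - g s) * b' u)"
  proof -
    have "\<exists>l z. z > s \<and> z < t \<and> (?Q has_real_derivative l) (at z) \<and> ?Q t - ?Q s = (t - s) * l"
      by (rule MVT[OF st contQ]) (use dQ real_differentiable_def in blast)
    then show ?thesis using dQ that by (metis DERIV_unique)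
  qed
  obtain v where v: "s < v" "v < u" "g u - g s = (u - s) * g' v"
  proof -
    have "\<exists>l z. z > s \<and> z < u \<and> (g has_real_derivative l) (at z) \<and> g u - g s = (u - s) * l"
    proof (rule MVT[OF u(1)])
      show "continuous_on {s..u} g" by (rule continuous_on_subset[OF g(1)]) (use u assms in auto)
      show "g differentiable (at x)" if "s < x" "x < u" for x
      proof -
        have "0 < x" "x < 1" using that u assms by auto
        from g(2)[OF this] show ?thesis unfolding real_differentiable_def by blast
      qed
    qed
    then obtain l z where z: "z > s" "z < u" "(g has_real_derivative l) (at z)" "g u - g s = (u - s) * l"
      by blast
    moreover have "l = g' z" using DERIV_unique[OF z(3) g(2)] z u assms by auto
    ultimately show ?thesis using that by blast
  qed
  have u0: "0 < u" "u \<le> 1" using u assms by auto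
  \<comment> \<open>The second mean value point \<open>v\<close> lies before \<open>u\<close>, so
    the bound on \<open>g'\<close> can be moved to \<open>u\<close>, where it meets
    \<open>b' u\<close>.\<close>
  have "\<bar>g' v\<bar> \<le> C * u ^ (n + 2)"
  proof -
    have "\<bar>g' v\<bar> \<le> C * v ^ (n + 2)" using v u assms by (intro g'_le) auto
    also have "\<dots> \<le> C * u ^ (n + 2)" using v assms by (intro mult_left_mono power_mono) auto
    finally show ?thesis .
  qed
  then have "\<bar>g' v\<bar> * \<bar>b' u\<bar> \<le> (C * u ^ (n + 2)) * (2 / u ^ (n + 2))"
    using b'_bound[OF u0] assms by (intro mult_mono) auto
  also have "\<dots> = 2 * C" using u0 by simp
  finally have gb: "\<bar>g' v\<bar> * \<bar>b' u\<bar> \<le> 2 * C" .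
  have "P t - P s - (b t - b s) * g s = (t - s) * ((u - s) * g' v * b' u)"
    using u(3) unfolding v(3) by (simp add: algebra_simps)
  then have "\<bar>P t - P s - (b t - b s) * g s\<bar> = (t - s) * ((u - s) * (\<bar>g' v\<bar> * \<bar>b' u\<bar>))"
    using u by (simp add: abs_mult)
  also have "\<dots> \<le> (t - s) * ((t - s) * (2 * C))"
    using u assms by (intro mult_left_mono mult_mono[OF _ gb]) auto
  finally show ?thesis by (simp add: power2_eq_square mult_ac)
qed simp

text \<open>Where \<open>q\<close> is positive, the drift removes what \<open>b'\<close> adds to the
  normal coordinate beyond the prescribed \<open>Z t * \<eta> t\<close>; the term with the square of
  \<open>\<eta>\<close> comes from the growth of \<open>Z\<close>. Where \<open>q\<close> is not
  positive, this density vanishes and \<open>push_density\<close> cancels \<open>b'\<close>.\<close>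

definition drift_density :: "real \<Rightarrow> real" where
  "drift_density t = Z t * (qp t * (1 - (\<eta> t)\<^sup>2) / t ^ (n + 2) - \<eta>' t)"

definition push_density :: "real \<Rightarrow> real" where
  "push_density t = Z t * (max 0 (- q t) / t ^ (n + 2))"

text \<open>Half of \<open>qp t / t ^ (n + 2)\<close> survives the factor
  \<open>1 - (\<eta> t)\<^sup>2\<close>, and by \<open>\<eta>'_upper\<close> half of it dominates
  \<open>\<eta>'\<close>.\<close>

lemma drift_density_nonneg:
  assumes "0 \<le> t" "t \<le> 1" shows "0 \<le> drift_density t"
proof (cases "t = 0")
  case False
  then have t: "0 < t" using assms by simp
  have "\<eta> t \<le> 1 / 2" using \<eta>_bounds(2)[OF assms] \<epsilon>(2) by linarith
  then have "(\<eta> t)\<^sup>2 \<le> (1 / 2)\<^sup>2" using \<eta>_bounds(1)[OF assms] by (intro power_mono) auto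
  then have "1 / 2 \<le> 1 - (\<eta> t)\<^sup>2" by (simp add: power2_eq_square)
  then have "qp t * (1 / 2) / t ^ (n + 2) \<le> qp t * (1 - (\<eta> t)\<^sup>2) / t ^ (n + 2)"
    using t qp_bounds(1) by (intro divide_right_mono mult_left_mono) auto
  moreover have "\<bar>\<eta>' t\<bar> \<le> qp t * (1 / 2) / t ^ (n + 2)" using \<eta>'_upper[OF t assms(2)] by simp
  ultimately have "0 \<le> qp t * (1 - (\<eta> t)\<^sup>2) / t ^ (n + 2) - \<eta>' t" by linarith
  then show ?thesis unfolding drift_density_def by (intro mult_nonneg_nonneg Z_nonneg)
qed (simp add: drift_density_def)

lemma push_density_nonneg: "0 \<le> t \<Longrightarrow> 0 \<le> push_density t"
  unfolding push_density_def by (intro mult_nonneg_nonneg Z_nonneg divide_nonneg_nonneg) auto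

lemma \<eta>'_bound: "0 < t \<Longrightarrow> t \<le> 1 \<Longrightarrow> \<bar>\<eta>' t\<bar> \<le> 1 / t ^ (n + 2)"
proof -
  assume t: "0 < t" "t \<le> 1"
  have "\<bar>\<eta>' t\<bar> \<le> qp t / (2 * t ^ (n + 2))" by (rule \<eta>'_upper[OF t])
  also have "\<dots> \<le> 2 / (2 * t ^ (n + 2))" using qp_bounds t by (intro divide_right_mono) auto
  finally show ?thesis by simp
qed

lemma continuous_drift_density: "continuous_on {0..1} drift_density"
  unfolding drift_density_def[abs_def]
proof (rule continuous_Z_times)
  show "continuous_on {0<..} (\<lambda>t. qp t * (1 - (\<eta> t)\<^sup>2) / t ^ (n + 2) - \<eta>' t)"
    by (intro continuous_intros continuous_qp continuous_\<eta> continuous_\<eta>') auto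
  show "\<bar>qp t * (1 - (\<eta> t)\<^sup>2) / t ^ (n + 2) - \<eta>' t\<bar> \<le> 3 / t ^ (n + 2)" if t: "0 < t" "t \<le> 1" for t
  proof -
    have "\<eta> t \<le> 1" using \<eta>_bounds(2)[of t] t \<epsilon>(2) by simp
    then have "(\<eta> t)\<^sup>2 \<le> 1" using \<eta>_bounds(1)[of t] t by (simp add: power_le_one)
    then have "\<bar>qp t * (1 - (\<eta> t)\<^sup>2)\<bar> \<le> 2 * 1"
      unfolding abs_mult using qp_bounds[of t] t by (intro mult_mono) auto
    then have "\<bar>qp t * (1 - (\<eta> t)\<^sup>2) / t ^ (n + 2)\<bar> \<le> 2 / t ^ (n + 2)"
      using t by (intro abs_divide_power_le) auto
    moreover have "3 / t ^ (n + 2) = 2 / t ^ (n + 2) + 1 / t ^ (n + 2)" by (simp flip: add_divide_distrib)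
    ultimately show ?thesis using \<eta>'_bound[OF t] by linarith
  qed
qed simp

lemma continuous_push_density: "continuous_on {0..1} push_density"
  unfolding push_density_def[abs_def]
proof (rule continuous_Z_times)
  show "continuous_on {0<..} (\<lambda>t. max 0 (- q t) / t ^ (n + 2))"
    by (intro continuous_intros continuous_q) auto
  show "\<bar>max 0 (- q t) / t ^ (n + 2)\<bar> \<le> 2 / t ^ (n + 2)" if t: "0 < t" "t \<le> 1" for t
  proof -
    have "\<bar>max 0 (- q t)\<bar> \<le> 2" using q_bound[of t] t by auto
    then show ?thesis using t by (intro abs_divide_power_le)
  qed
qed simp

section \<open>The accumulated push and the first-level remainders\<close>

definition push :: "real \<Rightarrow> real" where "push t = integral {0..t} push_density"


lemma push_mono: "mono_on {0..1} push"
  unfolding push_def[abs_def]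
  by (intro mono_on_indefinite_integral continuous_push_density push_density_nonneg)

lemma continuous_push: "continuous_on {0..1} push"
  unfolding push_def[abs_def] by (intro continuous_indefinite_integral continuous_push_density)

lemma continuous_Z: "continuous_on {0..1} Z"
  using continuous_Z_times[of "\<lambda>_. 1" 1 0] by simp

lemma continuous_Z\<eta>: "continuous_on {0..1} (\<lambda>t. Z t * \<eta> t)"
proof (rule continuous_Z_times[where l = 0])
  show "\<bar>\<eta> t\<bar> \<le> 1 / t ^ 0" if "0 < t" "t \<le> 1" for t
    using \<eta>_bounds[of t] \<epsilon>(2) that by simp
qed (simp_all add: continuous_\<eta>)

text \<open>Off the boundary \<open>q\<close> is positive, hence positive nearby by continuity, and
  there \<open>push_density\<close> is zero. This provides \<open>flat\<close> for the second
  solution.\<close>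

lemma push_locally_const:
  assumes "0 \<le> u" "u \<le> 1" "Z u * \<eta> u \<noteq> 0"
  shows "\<exists>e>0. \<forall>v. 0 \<le> v \<and> v \<le> 1 \<and> \<bar>v - u\<bar> < e \<longrightarrow> push v = push u"
proof -
  have u: "0 < u" using assms by (cases "u = 0") auto
  have "0 < q u" using assms by (auto simp: \<eta>_def qp_def max_def split: if_splits)
  moreover have "isCont q u" using u deriv_q[of u] DERIV_isCont by blast
  ultimately have "\<forall>\<^sub>F v in at u. 0 < q v"
    unfolding isCont_def by (metis order_tendstoD(1))
  then obtain d where d: "d > 0" "\<And>v. v \<noteq> u \<Longrightarrow> \<bar>v - u\<bar> < d \<Longrightarrow> 0 < q v"
    unfolding eventually_at by (auto simp: dist_real_def)
  have zero: "push_density x = 0" if "\<bar>x - u\<bar> < d" for x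
    using d(2)[of x] \<open>0 < q u\<close> that by (cases "x = u") (auto simp: push_density_def)
  show ?thesis
  proof (intro exI[of _ d] conjI allI impI)
    fix v assume v: "0 \<le> v \<and> v \<le> 1 \<and> \<bar>v - u\<bar> < d"
    show "push v = push u"
    proof (cases "u \<le> v")
      case True
      show ?thesis unfolding push_def
        by (rule indefinite_integral_locally_const[OF continuous_push_density]) (use True v assms zero in auto)
    next
      case False
      show ?thesis unfolding push_def
        by (rule indefinite_integral_locally_const[OF continuous_push_density, symmetric]) (use False v assms zero in auto)
    qed
  qed (rule d)
qed

text \<open>The densities are chosen so that the normal coordinate, freed of push and drift, has
  derivative \<open>Z t * b' t\<close>; \<open>second_order_remainder\<close> applies with
  \<open>Z\<close> as integrand.\<close>

lemma normal_remainder: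
  "\<exists>C. \<forall>s t. 0 \<le> s \<longrightarrow> s \<le> t \<longrightarrow> t \<le> 1 \<longrightarrow>
    \<bar>Z t * \<eta> t - Z s * \<eta> s - (push t - push s) + (integral {0..t} drift_density - integral {0..s} drift_density)
      - (b t - b s) * Z s\<bar> \<le> C * (t - s)\<^sup>2"
proof -
  let ?P = "\<lambda>t. Z t * \<eta> t - push t + integral {0..t} drift_density"
  obtain C where C: "0 \<le> C" "\<And>t. 0 < t \<Longrightarrow> t \<le> 1 \<Longrightarrow> \<bar>Z t * rate t\<bar> \<le> C * t ^ (n + 2)"
    using Z_times_bound[of rate 1 2 "n + 2"] rate_bounds by fastforce
  have "\<bar>?P t - ?P s - (b t - b s) * Z s\<bar> \<le> 2 * C * (t - s)\<^sup>2" if "0 \<le> s" "s \<le> t" "t \<le> 1" for s t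
  proof (rule second_order_remainder[of ?P Z "\<lambda>t. Z t * rate t"])
    show "continuous_on {0..1} ?P"
      by (intro continuous_intros continuous_Z\<eta> continuous_push continuous_indefinite_integral continuous_drift_density)
    fix t :: real assume t: "0 < t" "t < 1"
    have "(?P has_real_derivative Z t * rate t * \<eta> t + \<eta>' t * Z t - push_density t + drift_density t) (at t)"
      unfolding push_def using t
      by (intro DERIV_add DERIV_diff DERIV_mult deriv_Z deriv_\<eta> deriv_indefinite_integral
          continuous_push_density continuous_drift_density) auto
    moreover have "Z t * rate t * \<eta> t + \<eta>' t * Z t - push_density t + drift_density t = Z t * b' t"
    proof -
      let ?T = "1 / t ^ (n + 2)"
      have "rate t * \<eta> t = (\<eta> t)\<^sup>2 * qp t * ?T"
        unfolding rate_eq[OF t(1), symmetric] by (auto simp: b'_def \<eta>_def qp_def max_def power2_eq_square)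
      moreover have "q t = qp t - max 0 (- q t)" by (auto simp: qp_def)
      then have "b' t = (qp t - max 0 (- q t)) * ?T" by (simp add: b'_def)
      ultimately show ?thesis
        unfolding push_density_def drift_density_def mult.assoc by (simp only: divide_inverse) (simp only: algebra_simps)
    qed
    ultimately show "(?P has_real_derivative Z t * b' t) (at t)" by simp
    show "(Z has_real_derivative Z t * rate t) (at t)" by (rule deriv_Z[OF t])
    show "\<bar>Z t * rate t\<bar> \<le> C * t ^ (n + 2)" using C(2) t by simp
  qed (use that C continuous_Z in auto)
  then have "\<bar>Z t * \<eta> t - Z s * \<eta> s - (push t - push s) + (integral {0..t} drift_density - integral {0..s} drift_density)
      - (b t - b s) * Z s\<bar> \<le> 2 * C * (t - s)\<^sup>2" if "0 \<le> s" "s \<le> t" "t \<le> 1" for s t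
    using that by (smt (verit))
  then show ?thesis by blast
qed

text \<open>By \<open>rate_eq\<close>, \<open>Z\<close> is the integral of
  \<open>Z t * \<eta> t\<close> against \<open>b\<close>. The derivative of this integrand explodes
  only polynomially up to the factor \<open>Z\<close>, as \<open>second_order_remainder\<close>
  requires.\<close>

lemma tangential_remainder:
  "\<exists>C. \<forall>s t. 0 \<le> s \<longrightarrow> s \<le> t \<longrightarrow> t \<le> 1 \<longrightarrow>
    \<bar>Z t - Z s - (b t - b s) * (Z s * \<eta> s)\<bar> \<le> C * (t - s)\<^sup>2"
proof -
  have "\<bar>rate t * \<eta> t + \<eta>' t\<bar> \<le> 2 / t ^ (n + 2)" if t: "0 < t" "t \<le> 1" for t
  proof -
    have "rate t * \<eta> t \<le> 1 / t\<^sup>2 * 1"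
      using rate_bounds[OF t] \<eta>_bounds[of t] \<epsilon>(2) t by (intro mult_mono) auto
    also have "\<dots> \<le> 1 / t ^ (n + 2)" using inverse_power_mono[OF t, of 2 "n + 2"] by simp
    finally have "rate t * \<eta> t \<le> 1 / t ^ (n + 2)" .
    moreover have "0 \<le> rate t * \<eta> t" using rate_bounds[OF t] \<eta>_bounds[of t] t by simp
    moreover have "2 / t ^ (n + 2) = 1 / t ^ (n + 2) + 1 / t ^ (n + 2)" by simp
    ultimately show ?thesis using \<eta>'_bound[OF t] by linarith
  qed
  then obtain C where C: "0 \<le> C" "\<And>t. 0 < t \<Longrightarrow> t \<le> 1 \<Longrightarrow> \<bar>Z t * (rate t * \<eta> t + \<eta>' t)\<bar> \<le> C * t ^ (n + 2)"
    using Z_times_bound[of "\<lambda>t. rate t * \<eta> t + \<eta>' t" 2 "n + 2" "n + 2"] by auto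
  have "\<bar>Z t - Z s - (b t - b s) * (Z s * \<eta> s)\<bar> \<le> 2 * C * (t - s)\<^sup>2" if "0 \<le> s" "s \<le> t" "t \<le> 1" for s t
  proof (rule second_order_remainder[of Z "\<lambda>t. Z t * \<eta> t" "\<lambda>t. Z t * (rate t * \<eta> t + \<eta>' t)"])
    fix t :: real assume t: "0 < t" "t < 1"
    show "(Z has_real_derivative Z t * \<eta> t * b' t) (at t)"
      using deriv_Z[OF t] rate_eq[OF t(1)] by (simp add: mult.assoc)
    have "((\<lambda>t. Z t * \<eta> t) has_real_derivative Z t * rate t * \<eta> t + \<eta>' t * Z t) (at t)"
      using t by (intro DERIV_mult deriv_Z deriv_\<eta>) auto
    then show "((\<lambda>t. Z t * \<eta> t) has_real_derivative Z t * (rate t * \<eta> t + \<eta>' t)) (at t)"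
      by (simp add: algebra_simps)
    show "\<bar>Z t * (rate t * \<eta> t + \<eta>' t)\<bar> \<le> C * t ^ (n + 2)" using C(2) t by simp
  qed (use that C continuous_Z continuous_Z\<eta> in auto)
  then show ?thesis by blast
qed

end

section \<open>Two solutions\<close>

locale reflected_chirp =
  chirp n + rough_drift_lift "chirp.b n" "chirp.drift_density n" i j "chirp.b' n" p H M
  for n :: nat and i j :: "'m::finite" and p H M :: real +
  fixes a c :: "'d::euclidean_space"
  assumes norm_a: "norm a = 1" and norm_c: "norm c = 1" and orth: "a \<bullet> c = 0"
begin

abbreviation D :: "'d set" where "D \<equiv> {y. 0 \<le> a \<bullet> y}"
abbreviation f where "f \<equiv> swap_drift_field i j a c"

definition Y :: "real \<Rightarrow> 'd" where "Y t = (Z t * \<eta> t) *\<^sub>R a + Z t *\<^sub>R c"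

lemma inner_simps: "a \<bullet> a = 1" "c \<bullet> c = 1" "c \<bullet> a = 0"
  using norm_a norm_c orth by (simp_all add: dot_square_norm inner_commute)

lemma inner_Y: "a \<bullet> Y t = Z t * \<eta> t" "c \<bullet> Y t = Z t"
  using orth by (simp_all add: Y_def inner_add_right inner_simps)

lemma norm_combination: "norm (x *\<^sub>R a + y *\<^sub>R c) \<le> \<bar>x\<bar> + \<bar>y\<bar>"
  using norm_triangle_ineq[of "x *\<^sub>R a" "y *\<^sub>R c"] norm_a norm_c by simp

text \<open>At the origin the field of \<open>j\<close> vanishes and reflection cancels the drift
  exactly, so the first-level remainder is zero. The path never leaves the boundary, so
  \<open>flat\<close> is vacuous.\<close>

lemma trivial_solution:
  "reflected_RDE_solution p D X f 0 (\<lambda>t. 0) (\<lambda>t. integral {0..t} drift_density *\<^sub>R a)"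
proof -
  let ?K = "\<lambda>t. integral {0..t} drift_density"
  have K: "mono_on {0..1} ?K" "continuous_on {0..1} ?K"
    by (rule mono_on_indefinite_integral[OF continuous_drift_density], rule drift_density_nonneg, assumption+)
      (rule continuous_indefinite_integral[OF continuous_drift_density])
  show ?thesis
    unfolding reflected_RDE_solution_def
  proof (intro conjI)
    show "bounded_variation_01 (\<lambda>t. ?K t *\<^sub>R a)" by (rule bounded_variation_mono_path[OF K(1) norm_a])
    show "reflection_condition D (\<lambda>t. 0) (\<lambda>t. ?K t *\<^sub>R a)"
      by (rule reflection_condition_half_space[OF norm_a K continuous_on_const]) simp
    show "rough_integral_equation p X f (\<lambda>t. 0) (\<lambda>t. ?K t *\<^sub>R a)"
    proof (rule rough_integral_equationI[where ?C1.0 = 0])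
      fix s t :: real assume st: "0 \<le> s" "s \<le> t" "t \<le> 1"
      show "norm (0 - 0 - (?K t *\<^sub>R a - ?K s *\<^sub>R a) - (b t - b s) *\<^sub>R ((c \<bullet> 0) *\<^sub>R a + (a \<bullet> 0) *\<^sub>R c)
          + integral {s..t} drift_density *\<^sub>R a) \<le> 0 * (t - s)\<^sup>2"
        unfolding integral_r_diff[OF st] by (simp add: scaleR_diff_left)
    qed (rule exI[of _ 0], simp)
    show "continuous_on {0..1} (\<lambda>t. ?K t *\<^sub>R a)" by (intro continuous_intros K(2))
  qed simp_all
qed

text \<open>On an interval starting at \<open>s > 0\<close>, the Lipschitz constant of
  \<open>b\<close> is of order \<open>1 / s ^ (n + 2)\<close>, so a word of length \<open>l\<close>
  costs the power \<open>l\<close> of it. \<open>Z_decay\<close> with exponent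
  \<open>(n + 2) * l\<close> pays for this, and \<open>2 \<le> l\<close> leaves a quadratic bound.
  For \<open>s = 0\<close> the factor \<open>norm (Y s)\<close> is zero.\<close>

lemma X_Y_bound: "\<exists>C. \<forall>s t. 0 \<le> s \<longrightarrow> s \<le> t \<longrightarrow> t \<le> 1 \<longrightarrow> \<bar>X s t (j # w)\<bar> * norm (Y s) \<le> C * (t - s)\<^sup>2"
  if w: "1 \<le> length w"
proof -
  define l where "l = length (j # w)"
  have l: "2 \<le> l" using w by (simp add: l_def)
  obtain C where C: "0 \<le> C" "\<And>t. 0 \<le> t \<Longrightarrow> t \<le> 1 \<Longrightarrow> Z t \<le> C * t ^ ((n + 2) * l)"
    using Z_decay[of "(n + 2) * l"] by blast
  have "\<bar>X s t (j # w)\<bar> * norm (Y s) \<le> 2 * C * (2 + M) ^ l * (t - s)\<^sup>2" if st: "0 \<le> s" "s \<le> t" "t \<le> 1" for s t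
  proof (cases "s = 0")
    case True
    then show ?thesis using C M_nonneg by (simp add: Y_def)
  next
    case False
    then have s: "0 < s" "s \<le> 1" using st by auto
    let ?S = "s ^ (n + 2)"
    have S: "0 < ?S" "?S \<le> 1" using s by (auto simp: power_le_one simp del: power_Suc)
    have "\<bar>X s t (j # w)\<bar> \<le> ((2 / ?S + M) * (t - s)) ^ l"
      unfolding l_def
    proof (rule X_Lipschitz[OF st])
      show "0 \<le> 2 / ?S" using S by simp
      show "\<bar>b v - b u\<bar> \<le> 2 / ?S * (v - u)" if "s \<le> u" "u \<le> v" "v \<le> t" for u v
        using that s st by (intro b_Lipschitz) auto
    qed
    also have "\<dots> \<le> ((2 + M) / ?S * (t - s)) ^ l"
    proof -
      have "M * 1 \<le> M * (1 / ?S)" using S M_nonneg by (intro mult_left_mono) auto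
      then have "2 / ?S + M \<le> (2 + M) / ?S" by (simp add: add_divide_distrib)
      moreover have "0 \<le> 2 / ?S + M" using S M_nonneg by simp
      ultimately show ?thesis using st by (intro power_mono mult_right_mono) auto
    qed
    also have "\<dots> = (2 + M) ^ l / ?S ^ l * (t - s) ^ l" by (simp only: power_mult_distrib power_divide)
    also have "\<dots> \<le> (2 + M) ^ l / ?S ^ l * (t - s)\<^sup>2"
      using M_nonneg S st l by (intro mult_left_mono power_decreasing divide_nonneg_nonneg zero_le_power) auto
    finally have 1: "\<bar>X s t (j # w)\<bar> \<le> (2 + M) ^ l / ?S ^ l * (t - s)\<^sup>2" .
    have "norm (Y s) \<le> norm ((Z s * \<eta> s) *\<^sub>R a) + norm (Z s *\<^sub>R c)"
      unfolding Y_def by (rule norm_triangle_ineq)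
    also have "\<dots> = Z s * (\<eta> s + 1)"
      using Z_nonneg[of s] \<eta>_bounds[of s] s norm_a norm_c by (simp add: abs_mult algebra_simps)
    also have "\<dots> \<le> (C * s ^ ((n + 2) * l)) * 2"
      using C s \<eta>_bounds[of s] \<epsilon>(2) Z_nonneg[of s] by (intro mult_mono) auto
    also have "s ^ ((n + 2) * l) = ?S ^ l" by (rule power_mult)
    finally have 2: "norm (Y s) \<le> (C * ?S ^ l) * 2" .
    have "\<bar>X s t (j # w)\<bar> * norm (Y s) \<le> ((2 + M) ^ l / ?S ^ l * (t - s)\<^sup>2) * ((C * ?S ^ l) * 2)"
      by (rule mult_mono[OF 1 2]) (use M_nonneg S in auto)
    also have "\<dots> = 2 * C * (2 + M) ^ l * (t - s)\<^sup>2"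
    proof -
      have "A / R * x * (C * R * 2) = 2 * C * A * x" if "R \<noteq> 0" for A R x :: real
        using that by (simp add: field_simps)
      moreover have "?S ^ l \<noteq> 0" using s by simp
      ultimately show ?thesis by blast
    qed
    finally show ?thesis .
  qed
  then show ?thesis by blast
qed

lemma nontrivial_solution: "reflected_RDE_solution p D X f 0 Y (\<lambda>t. push t *\<^sub>R a)"
  unfolding reflected_RDE_solution_def
proof (intro conjI)
  show contY: "continuous_on {0..1} Y"
    unfolding Y_def[abs_def] by (intro continuous_intros continuous_Z continuous_Z\<eta>)
  show "continuous_on {0..1} (\<lambda>t. push t *\<^sub>R a)" by (intro continuous_intros continuous_push)
  show "Y 0 = 0" by (simp add: Y_def)
  show "push 0 *\<^sub>R a = 0" by (simp add: push_def)
  show "bounded_variation_01 (\<lambda>t. push t *\<^sub>R a)" by (rule bounded_variation_mono_path[OF push_mono norm_a])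
  show "\<forall>t\<in>{0..1}. Y t \<in> D" using Z_nonneg \<eta>_bounds(1) by (auto simp: inner_Y)
  show "reflection_condition D Y (\<lambda>t. push t *\<^sub>R a)"
    using push_locally_const
    by (intro reflection_condition_half_space norm_a push_mono continuous_push contY) (simp add: inner_Y)
  obtain C1 where C1: "\<And>s t. 0 \<le> s \<Longrightarrow> s \<le> t \<Longrightarrow> t \<le> 1 \<Longrightarrow>
    \<bar>Z t * \<eta> t - Z s * \<eta> s - (push t - push s) + (integral {0..t} drift_density - integral {0..s} drift_density)
      - (b t - b s) * Z s\<bar> \<le> C1 * (t - s)\<^sup>2"
    using normal_remainder by blast
  obtain C2 where C2: "\<And>s t. 0 \<le> s \<Longrightarrow> s \<le> t \<Longrightarrow> t \<le> 1 \<Longrightarrow>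
    \<bar>Z t - Z s - (b t - b s) * (Z s * \<eta> s)\<bar> \<le> C2 * (t - s)\<^sup>2"
    using tangential_remainder by blast
  show "rough_integral_equation p X f Y (\<lambda>t. push t *\<^sub>R a)"
  proof (rule rough_integral_equationI[where ?C1.0 = "C1 + C2"])
    fix s t :: real assume st: "0 \<le> s" "s \<le> t" "t \<le> 1"
    let ?A = "Z t * \<eta> t - Z s * \<eta> s - (push t - push s) + (integral {0..t} drift_density - integral {0..s} drift_density)
      - (b t - b s) * Z s"
    let ?B = "Z t - Z s - (b t - b s) * (Z s * \<eta> s)"
    \<comment> \<open>The remainder splits along \<open>a\<close> and \<open>c\<close> into the
      quantities of \<open>normal_remainder\<close> and \<open>tangential_remainder\<close>.\<close>
    have eq: "Y t - Y s - (push t *\<^sub>R a - push s *\<^sub>R a) - (b t - b s) *\<^sub>R ((c \<bullet> Y s) *\<^sub>R a + (a \<bullet> Y s) *\<^sub>R c)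
        + integral {s..t} drift_density *\<^sub>R a = ?A *\<^sub>R a + ?B *\<^sub>R c"
      unfolding inner_Y integral_r_diff[OF st] unfolding Y_def by (simp add: algebra_simps)
    show "norm (Y t - Y s - (push t *\<^sub>R a - push s *\<^sub>R a) - (b t - b s) *\<^sub>R ((c \<bullet> Y s) *\<^sub>R a + (a \<bullet> Y s) *\<^sub>R c)
        + integral {s..t} drift_density *\<^sub>R a) \<le> (C1 + C2) * (t - s)\<^sup>2"
      unfolding eq distrib_right by (rule order.trans[OF norm_combination add_mono[OF C1[OF st] C2[OF st]]])
  qed (rule X_Y_bound)
qed

lemma Y_1_nonzero: "Y 1 \<noteq> 0"
proof
  assume "Y 1 = 0"
  then have "c \<bullet> Y 1 = 0" by simp
  then show False by (simp add: inner_Y)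
qed

end

theorem theorem1p1:
  fixes p :: real
  assumes "CARD('d::finite) \<ge> 2" and "CARD('m::finite) \<ge> 2" and "p > 2"
  shows "\<not> (\<forall>(D :: (real ^ 'd) set) (x :: real \<Rightarrow> real ^ 'm) (X :: 'm tensor_flow)
              (f :: real ^ 'd \<Rightarrow> (real ^ 'm) \<Rightarrow>\<^sub>L (real ^ 'd)) (y\<^sub>0 :: real ^ 'd).
            smooth_domain D \<and> rough_path p x X \<and> smooth_on UNIV f \<and> y\<^sub>0 \<in> D \<longrightarrow>
            (\<forall>Y \<kappa> Y' \<kappa>'.
               reflected_RDE_solution p D X f y\<^sub>0 Y \<kappa> \<and>
               reflected_RDE_solution p D X f y\<^sub>0 Y' \<kappa>' \<longrightarrow>
               (\<forall>t\<in>{0..1}. Y t = Y' t \<and> \<kappa> t = \<kappa>' t)))"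
proof
  assume uniq: "\<forall>(D :: (real ^ 'd) set) (x :: real \<Rightarrow> real ^ 'm) (X :: 'm tensor_flow)
              (f :: real ^ 'd \<Rightarrow> (real ^ 'm) \<Rightarrow>\<^sub>L (real ^ 'd)) (y\<^sub>0 :: real ^ 'd).
            smooth_domain D \<and> rough_path p x X \<and> smooth_on UNIV f \<and> y\<^sub>0 \<in> D \<longrightarrow>
            (\<forall>Y \<kappa> Y' \<kappa>'.
               reflected_RDE_solution p D X f y\<^sub>0 Y \<kappa> \<and>
               reflected_RDE_solution p D X f y\<^sub>0 Y' \<kappa>' \<longrightarrow>
               (\<forall>t\<in>{0..1}. Y t = Y' t \<and> \<kappa> t = \<kappa>' t))"
  obtain k l :: 'd where kl: "k \<noteq> l" using exists_distinct[OF assms(1)] by blast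
  obtain i j :: 'm where ij: "i \<noteq> j" using exists_distinct[OF assms(2)] by blast
  \<comment> \<open>Equivalent to \<open>2 * n + 2 < n * p\<close>, which yields the hypothesis of
    \<open>b_Hoelder\<close>; such an \<open>n\<close> exists because \<open>p > 2\<close>.\<close>
  obtain n where n_large: "2 < real n * (p - 2)" using reals_Archimedean3[of "p - 2"] assms(3) by auto
  have "1 \<le> n" using n_large by (cases n) auto
  then interpret chirp n by unfold_locales
  have "bounded (drift_density ` {0..1})"
    by (intro compact_imp_bounded compact_continuous_image continuous_drift_density) auto
  then obtain M where M: "\<forall>y\<in>drift_density ` {0..1}. norm y \<le> M"
    unfolding bounded_iff by blast
  interpret reflected_chirp n i j p "2 ^ (n + 3)" M "axis k 1 :: real ^ 'd" "axis l 1"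
  proof unfold_locales
    show "\<bar>b t - b s\<bar> \<le> 2 ^ (n + 3) * (t - s) powr (1 / p)" if "0 \<le> s" "s \<le> t" "t \<le> 1" for s t
      using that n_large assms(3) by (intro b_Hoelder) (auto simp: algebra_simps)
    show "\<bar>drift_density t\<bar> \<le> M" if "0 \<le> t" "t \<le> 1" for t using M that by simp
  qed (use ij kl assms(3) deriv_b continuous_b continuous_drift_density in \<open>auto simp: inner_axis_axis\<close>)
  have "smooth_domain D" by (rule smooth_domain_half_space[OF norm_a])
  then have "smooth_domain D \<and> rough_path p driver X \<and> smooth_on UNIV f \<and> 0 \<in> D"
    using rough_path_X smooth_swap_drift_field by auto
  \<comment> \<open>The two solutions are compared at time 1, where the second has tangential
    coordinate \<open>Z 1 = 1\<close>.\<close>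
  from uniq[rule_format, OF this conjI[OF nontrivial_solution trivial_solution], of 1]
  show False using Y_1_nonzero by simp
qed

end
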